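(* Assume the setting described in the context ($\xi$ in the domain of attraction of the normal law, $\alpha=2$, with normalising sequence $(a_n)$ and centering $b_n=n\mu$), and assume that $\overline F$ is intermediate regularly varying. If $(x_n)$ is a positive sequence with $\lim_{n\to\infty}\frac{x_n}{a_n}=\infty$ and $\lim_{n\to\infty}\frac{x_n}{n}=0$, then with $r_n=r(n/x_n)$ we have, as $n\to\infty$, $$\mathbb P(S_n-b_n\ge x_n,\ M_n>r_n)\sim\mathbb P(S_n-b_n\ge x_n,\ M_n\ge x_n),$$ or equivalently $$\mathbb P(S_n-b_n\ge x_n)=\mathbb P(S_n-b_n\ge x_n,\ M_n\le r_n)+(1+o(1))\,n\overline F(x_n).$$ If instead $\liminf_{n\to\infty}\frac{x_n}{n}>0$, then $$\mathbb P(S_n-b_n\ge x_n)\sim\mathbb P(S_n-b_n\ge x_n,\ M_n\ge x_n)\sim n\overline F(x_n).$$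
   Context: $\xi$ is a real random variable, $\xi_1,\xi_2,\dots$ are i.i.d. copies, $F(x)=\mathbb P(\xi\le x)$, $\overline F=1-F$, $S_n=\sum_{i=1}^n\xi_i$, $M_n=\max\{\xi_1,\dots,\xi_n\}$. Setting "$\alpha=2$": $\mathbb E|\xi|<\infty$, $\mu=\mathbb E[\xi]$, and the truncated variance $\sigma^2(x)=\mathbb E[(\xi-\mu)^2\mathbf 1_{\{|\xi-\mu|\le x\}}]$ is slowly varying as $x\to\infty$ (the variance may be finite or infinite). $(a_n)$ is a positive sequence, $a_n\to\infty$, with $\sigma^2(a_n)a_n^{-2}\sim n^{-1}$; $b_n=n\mu$. Threshold: fix a function $r:(0,\infty)\to\mathbb R_+$ with $r(t)\to\infty$ and $\frac{r(t)}{\sigma^2(r(t))}\sim t$ as $t\to\infty$; put $r_n=r(n/x_n)$. Thus if $x_n/n\to0$ then $r_n\to\infty$ and $\frac{r_n}{\sigma^2(r_n)}\sim\frac{n}{x_n}$. A (eventually positive) function $f$ is intermediate regularly varying if $\lim_{\lambda\downarrow1}\liminf_{x\to\infty}\frac{f(\lambda x)}{f(x)}=\lim_{\lambda\downarrow1}\limsup_{x\to\infty}\frac{f(\lambda x)}{f(x)}=1$. *)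

theory Defs
  imports "HOL-Probability.Probability" "HOL-Library.Landau_Symbols"
begin

definition tail :: "'a measure \<Rightarrow> ('a \<Rightarrow> real) \<Rightarrow> real \<Rightarrow> real" where
  "tail M \<xi> x = 1 - cdf (distr M borel \<xi>) x"

definition trunc_var :: "'a measure \<Rightarrow> ('a \<Rightarrow> real) \<Rightarrow> real \<Rightarrow> real" where
  "trunc_var M \<xi> x =
     (let \<mu> = (\<integral>\<omega>. \<xi> \<omega> \<partial>M)
      in \<integral>\<omega>. (\<xi> \<omega> - \<mu>)\<^sup>2 * indicator {\<omega>. \<bar>\<xi> \<omega> - \<mu>\<bar> \<le> x} \<omega> \<partial>M)"

text \<open>
  Measurability, often part of the definition of slow variation, is omitted: the only function
  to which the notion is applied below, \<^const>\<open>trunc_var\<close>, is monotone.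
\<close>

definition slowly_varying :: "(real \<Rightarrow> real) \<Rightarrow> bool" where
  "slowly_varying f \<longleftrightarrow>
     (\<forall>\<^sub>F x in at_top. f x > 0) \<and>
     (\<forall>c>0. ((\<lambda>x. f (c * x) / f x) \<longlongrightarrow> 1) at_top)"

definition intermediate_regularly_varying :: "(real \<Rightarrow> real) \<Rightarrow> bool" where
  "intermediate_regularly_varying f \<longleftrightarrow>
     (\<forall>\<^sub>F x in at_top. f x > 0) \<and>
     ((\<lambda>c. Liminf at_top (\<lambda>x. ereal (f (c * x) / f x))) \<longlongrightarrow> 1) (at_right 1) \<and>
     ((\<lambda>c. Limsup at_top (\<lambda>x. ereal (f (c * x) / f x))) \<longlongrightarrow> 1) (at_right 1)"

text \<open>
  Sequences are indexed from 1. The value of \<open>partial_max\<close> at \<open>n = 0\<close> is unspecified; all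
  statements in which it occurs are asymptotic or restricted to \<open>n \<ge> 1\<close>.
\<close>

definition partial_sum :: "(nat \<Rightarrow> 'a \<Rightarrow> real) \<Rightarrow> nat \<Rightarrow> 'a \<Rightarrow> real" where
  "partial_sum X n \<omega> = (\<Sum>i=1..n. X i \<omega>)"

definition partial_max :: "(nat \<Rightarrow> 'a \<Rightarrow> real) \<Rightarrow> nat \<Rightarrow> 'a \<Rightarrow> real" where
  "partial_max X n \<omega> = Max ((\<lambda>i. X i \<omega>) ` {1..n})"

end

(*
  One big jump. After centring, let V be the truncated variance, U the truncated first absolute
  moment above the truncation level and G the upper tail of a summand. Slow variation of V gives
  U(y) = o(V(y)/y) and makes V(y)/y almost decreasing, so that a Chernoff bound for summands
  truncated at y shows that n summands below y add up to x/2 only with probability exp(-c x/y) as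
  soon as n V(y)/y = O(x). This holds for every y above the threshold (r_n, or a large constant
  when x_n is of order at least n). Intermediate regular variation makes G decay at most
  polynomially, hence a sum x whose largest summand lies in a dyadic block between the threshold
  and eps x has probability at most a small multiple of n G(x), summably over the blocks. A largest
  summand between eps x and (1 - eps) x forces the others to deviate by eps x, which the weak law
  excludes; one above (1 - eps) x costs n G((1 - eps) x), close to n G(x). Conversely, the events
  that exactly one summand exceeds c x, c > 1, while the others sum to at least -(c - 1) x are
  disjoint and have total probability close to n G(c x).
*)
theory Submission
  imports Defs "HOL-Real_Asymp.Real_Asymp"
begin

section \<open>The law of a centred summand\<close>

text \<open>In the Chernoff exponent with parameter k / y the gain is k x / (2 y) and the loss is n
  (k U(y) / y + k^2 exp(k) V(y) / y^2). When n V(y) / y is merely comparable to x, shrinking k makes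
  the quadratic term negligible, but the first-order term scales like the gain. Karamata's bound
  resolves this: U(y) <= k V(y) / y makes the whole loss quadratic in k, and k is then fixed by the
  constant L in n V(y) / y <= L x. The order of choices matters: k and the admissible level R depend
  on L and the law alone, and only afterwards is eps chosen from the desired precision e. Hence for
  x_n of order at least n one constant truncation level serves every e. The conditions on the
  maximum are treated by inclusion: an event that for each c > 1 eventually contains {S >= x, some
  summand > c x}, and that eventually lies within {S >= x, some summand above half the threshold},
  has probability equivalent to n G(x). Halving the threshold leaves room for the mean, by which
  centred and uncentred maxima differ.\<close>

lemma eventually_at_top_posE:
  assumes "eventually P (at_top :: real filter)"
  obtains R where "R > 0" "\<And>y. y \<ge> R \<Longrightarrow> P y"
proof -
  obtain N where N: "\<And>y. y \<ge> N \<Longrightarrow> P y"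
    using assms unfolding eventually_at_top_linorder by blast
  then show ?thesis
    using that[of "max N 1"] by simp
qed

text \<open>Taken about 0 and attached to a law: for the law of \<open>\<xi> - \<mu>\<close> this is
  \<open>trunc_var M \<xi>\<close>, so slow variation carries over unchanged.\<close>

definition trunc_second_moment :: "real measure \<Rightarrow> real \<Rightarrow> real" where
  "trunc_second_moment D y = (\<integral>t. t\<^sup>2 * indicator {t. \<bar>t\<bar> \<le> y} t \<partial>D)"

definition tail_moment :: "real measure \<Rightarrow> real \<Rightarrow> real" where
  "tail_moment D y = (\<integral>t. \<bar>t\<bar> * indicator {t. \<bar>t\<bar> > y} t \<partial>D)"

definition upper_tail :: "real measure \<Rightarrow> real \<Rightarrow> real" where
  "upper_tail D y = measure D {y<..}"

lemma upper_tail_nonneg: "0 \<le> upper_tail D y"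
  by (simp add: upper_tail_def)

lemma tail_moment_nonneg: "0 \<le> tail_moment D y"
  unfolding tail_moment_def by (rule integral_nonneg_AE) (auto simp: indicator_def)

lemma trunc_second_moment_nonneg: "0 \<le> trunc_second_moment D y"
  unfolding trunc_second_moment_def by (rule integral_nonneg_AE) (auto simp: indicator_def)

locale centered_law = prob_space D for D :: "real measure" +
  assumes sets_D [measurable_cong]: "sets D = sets borel"
    and integrable_id: "integrable D (\<lambda>t. t)"
    and mean_zero: "(\<integral>t. t \<partial>D) = 0"
begin

abbreviation "V \<equiv> trunc_second_moment D"
abbreviation "U \<equiv> tail_moment D"
abbreviation "G \<equiv> upper_tail D"

lemma space_D [simp]: "space D = UNIV"
  using sets_eq_imp_space_eq[OF sets_D] by simp

lemma integrable_trunc: "integrable D (\<lambda>t. t\<^sup>2 * indicator {t. \<bar>t\<bar> \<le> y} t)"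
proof (rule integrable_const_bound[where B = "y\<^sup>2"])
  show "AE t in D. norm (t\<^sup>2 * indicator {t. \<bar>t\<bar> \<le> y} t) \<le> y\<^sup>2"
    by (auto simp: indicator_def intro!: power2_le_iff_abs_le[THEN iffD2] order.trans[OF abs_ge_zero])
qed measurable

lemma integrable_tail: "integrable D (\<lambda>t. \<bar>t\<bar> * indicator {t. \<bar>t\<bar> > y} t)"
  by (rule Bochner_Integration.integrable_bound[OF integrable_id]) (auto simp: indicator_def)

lemma V_mono: "y \<le> z \<Longrightarrow> V y \<le> V z"
  unfolding trunc_second_moment_def
  by (rule integral_mono[OF integrable_trunc integrable_trunc]) (auto simp: indicator_def)

lemma G_antimono: "y \<le> z \<Longrightarrow> G z \<le> G y"
  unfolding upper_tail_def by (rule finite_measure_mono) (auto simp: sets_D)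

lemma U_tendsto_0: "(U \<longlongrightarrow> 0) at_top"
proof -
  have "((\<lambda>y. \<integral>t. \<bar>t\<bar> * indicator {t. \<bar>t\<bar> > y} t \<partial>D) \<longlongrightarrow> (\<integral>t. 0 \<partial>D)) at_top"
  proof (rule integral_dominated_convergence_at_top[where w = "\<lambda>t. \<bar>t\<bar>"])
    show "AE t in D. ((\<lambda>y. \<bar>t\<bar> * indicator {t. \<bar>t\<bar> > y} t) \<longlongrightarrow> 0) at_top"
    proof (rule AE_I2)
      fix t :: real
      have "eventually (\<lambda>y. \<bar>t\<bar> * indicator {t. \<bar>t\<bar> > y} t = (0::real)) at_top"
        using eventually_ge_at_top[of "\<bar>t\<bar>"] by eventually_elim auto
      then show "((\<lambda>y. \<bar>t\<bar> * indicator {t. \<bar>t\<bar> > y} t) \<longlongrightarrow> (0::real)) at_top"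
        by (rule tendsto_eventually)
    qed
    show "\<forall>\<^sub>F y in at_top. AE t in D. norm (\<bar>t\<bar> * indicator {t. \<bar>t\<bar> > y} t) \<le> \<bar>t\<bar>"
      by (intro always_eventually allI AE_I2) (simp split: split_indicator)
  qed (use integrable_abs[OF integrable_id] in simp_all)
  then show ?thesis
    unfolding tail_moment_def by simp
qed

text \<open>The finite mean supplies the dominating function: on |t| <= y one has t^2 / y <= |t|.
  This is what makes a constant truncation level sufficient when \<open>x n\<close> is of order at
  least n.\<close>

lemma V_over_tendsto_0: "((\<lambda>y. V y / y) \<longlongrightarrow> 0) at_top"
proof -
  have "((\<lambda>y. \<integral>t. t\<^sup>2 * indicator {t. \<bar>t\<bar> \<le> y} t / y \<partial>D) \<longlongrightarrow> (\<integral>t. 0 \<partial>D)) at_top"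
  proof (rule integral_dominated_convergence_at_top[where w = "\<lambda>t. \<bar>t\<bar>"])
    show "AE t in D. ((\<lambda>y. t\<^sup>2 * indicator {t. \<bar>t\<bar> \<le> y} t / y) \<longlongrightarrow> 0) at_top"
    proof (rule AE_I2)
      fix t :: real
      have "eventually (\<lambda>y. t\<^sup>2 / y = t\<^sup>2 * indicator {t. \<bar>t\<bar> \<le> y} t / y) at_top"
        using eventually_ge_at_top[of "\<bar>t\<bar>"] by eventually_elim auto
      moreover have "((\<lambda>y. t\<^sup>2 / y) \<longlongrightarrow> 0) at_top"
        by (intro tendsto_divide_0[OF tendsto_const] filterlim_at_top_imp_at_infinity filterlim_ident)
      ultimately show "((\<lambda>y. t\<^sup>2 * indicator {t. \<bar>t\<bar> \<le> y} t / y) \<longlongrightarrow> 0) at_top"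
        by (rule Lim_transform_eventually[rotated])
    qed
    show "eventually (\<lambda>y. AE t in D. norm (t\<^sup>2 * indicator {t. \<bar>t\<bar> \<le> y} t / y) \<le> \<bar>t\<bar>) at_top"
      using eventually_gt_at_top[of 0]
    proof eventually_elim
      case (elim y)
      have "t\<^sup>2 / y \<le> \<bar>t\<bar>" if "\<bar>t\<bar> \<le> y" for t
        using mult_left_mono[OF that, of "\<bar>t\<bar>"] elim
        by (simp add: divide_le_eq power2_eq_square)
      then show ?case
        using elim by (intro AE_I2) (auto simp: indicator_def)
    qed
  qed (use integrable_abs[OF integrable_id] in simp_all)
  then show ?thesis
    unfolding trunc_second_moment_def by simp
qed

text \<open>Second-order Taylor expansion on |t| <= y. Since the mean is 0, the linear term may be
  completed to the whole line; the completion costs at most k |t| / y on |t| > y, which is the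
  \<open>U\<close> term.\<close>

lemma truncated_mgf_le:
  assumes "y > 0" "k \<ge> 0" and s: "s = 1 \<or> s = -1"
  shows "(\<integral>t. exp (k * (s * t) / y) * indicator {t. s * t \<le> y} t \<partial>D)
           \<le> 1 + k * U y / y + k\<^sup>2 * exp k * V y / y\<^sup>2" (is "?l \<le> _")
proof -
  \<comment> \<open>A pointwise majorant of the integrand: Taylor's formula on |t| <= y; for s t < -
    y the two linear terms cancel and leave 1; for s t > y the integrand vanishes and
    \<open>f\<close> is nonnegative.\<close>
  define f where "f t = 1 + k / y * s * t + k / y * (\<bar>t\<bar> * indicator {t. \<bar>t\<bar> > y} t)
      + k\<^sup>2 * exp k / y\<^sup>2 * (t\<^sup>2 * indicator {t. \<bar>t\<bar> \<le> y} t)" for t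
  have pt: "exp (k * (s * t) / y) * indicator {t. s * t \<le> y} t \<le> f t" for t
  proof -
    consider "\<bar>t\<bar> \<le> y" | "s * t < - y" | "s * t > y"
      using s by fastforce
    then show ?thesis
    proof cases
      case 1
      define u where "u = k * (s * t) / y"
      have "\<bar>s * t\<bar> \<le> y"
        using 1 s by auto
      then have u: "\<bar>u\<bar> \<le> k"
        using assms unfolding u_def
        by (simp add: abs_mult divide_le_eq mult_left_mono)
      obtain v where v: "\<bar>v\<bar> \<le> \<bar>u\<bar>" "exp u = (\<Sum>m<2. u ^ m / fact m) + exp v / fact 2 * u ^ 2"
        using Maclaurin_exp_le[of u 2] by blast
      have "exp v / 2 \<le> exp k"
        using u v exp_ge_zero[of v] order.trans[of "exp v / 2" "exp v" "exp k"] by auto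
      then have "exp u \<le> 1 + u + exp k * u\<^sup>2"
        using v(2) mult_right_mono[of "exp v / 2" "exp k" "u\<^sup>2"] by (simp add: numeral_2_eq_2)
      moreover have "u\<^sup>2 = k\<^sup>2 / y\<^sup>2 * t\<^sup>2"
        using s by (auto simp: u_def power_divide power_mult_distrib)
      moreover have "s * t \<le> y"
        using \<open>\<bar>s * t\<bar> \<le> y\<close> by linarith
      ultimately show ?thesis
        using 1 by (simp add: f_def u_def mult_ac)
    next
      case 2
      then have "\<bar>t\<bar> > y" "\<bar>t\<bar> = - (s * t)"
        using s assms by auto
      moreover have "k * (s * t) / y \<le> 0"
        using 2 assms by (simp add: divide_nonpos_pos mult_nonneg_nonpos)
      ultimately show ?thesis
        using 2 assms by (simp add: f_def)
    next
      case 3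
      then have "\<bar>t\<bar> > y" "\<bar>t\<bar> = s * t"
        using s assms by auto
      then show ?thesis
        using 3 assms by (simp add: f_def)
    qed
  qed
  have int_f: "integrable D f"
    unfolding f_def[abs_def] by (intro Bochner_Integration.integrable_add integrable_mult_right
      integrable_trunc integrable_tail integrable_id integrable_const)
  have "integrable D (\<lambda>t. exp (k * (s * t) / y) * indicator {t. s * t \<le> y} t)"
    by (rule Bochner_Integration.integrable_bound[OF int_f])
      (use pt in \<open>auto simp: abs_le_iff intro: order.trans[OF _ abs_ge_self]\<close>)
  then have "?l \<le> integral\<^sup>L D f"
    by (rule integral_mono[OF _ int_f pt])
  also have "\<dots> = 1 + k * U y / y + k\<^sup>2 * exp k * V y / y\<^sup>2"
    unfolding f_def[abs_def] tail_moment_def trunc_second_moment_def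
    using integrable_id integrable_tail[of y] integrable_trunc[of y] mean_zero prob_space
    by (simp add: Bochner_Integration.integral_add)
  finally show ?thesis .
qed

section \<open>Consequences of slow variation and of regular decay of the tail\<close>

lemma V_double:
  assumes "slowly_varying V" "\<eta> > 0"
  shows "\<forall>\<^sub>F y in at_top. V (2 * y) \<le> (1 + \<eta>) * V y"
proof -
  have "((\<lambda>y. V (2 * y) / V y) \<longlongrightarrow> 1) at_top" and pos: "\<forall>\<^sub>F y in at_top. V y > 0"
    using assms(1) unfolding slowly_varying_def by auto
  then have "\<forall>\<^sub>F y in at_top. V (2 * y) / V y < 1 + \<eta>"
    using assms(2) by (auto intro: order_tendstoD)
  with pos show ?thesis
    by eventually_elim (simp add: field_simps)
qed

text \<open>Karamata's argument: \<open>U y - 4 * \<eta> * V y / y\<close> increases along \<open>y, 2 y, 4 y, \<dots>\<close> and has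
  limit at most 0.\<close>
lemma U_le_V:
  assumes "slowly_varying V" "d > 0"
  shows "\<forall>\<^sub>F y in at_top. U y \<le> d * V y / y"
proof -
  \<comment> \<open>The part 1 / 2 gives V(2 y) <= (3 / 2) V(y), so the correction 4 \<eta> V(y) / y
    drops to at most 3 \<eta> V(y) / y when y doubles. The drop of \<eta> V(y) / y pays for the
    block y < |t| <= 2 y of \<open>U\<close>. The part d / 4 keeps 4 \<eta> below d.\<close>
  define \<eta> where "\<eta> = min (d / 4) (1 / 2)"
  have \<eta>: "\<eta> > 0" "\<eta> \<le> 1 / 2" "4 * \<eta> \<le> d"
    using assms(2) by (auto simp: \<eta>_def)
  obtain R where R: "R > 0" "\<And>y. y \<ge> R \<Longrightarrow> V (2 * y) \<le> (1 + \<eta>) * V y"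
    by (rule eventually_at_top_posE[OF V_double[OF assms(1) \<eta>(1)]]) blast
  define g where "g y = U y - 4 * \<eta> * V y / y" for y
  have step: "g y \<le> g (2 * y)" if "y \<ge> R" for y
  proof -
    have y: "y > 0"
      using that R by linarith
    have "U y - U (2 * y) = (\<integral>t. \<bar>t\<bar> * indicator {t. \<bar>t\<bar> > y} t - \<bar>t\<bar> * indicator {t. \<bar>t\<bar> > 2 * y} t \<partial>D)"
      unfolding tail_moment_def by (simp add: integrable_tail)
    also have "\<dots> \<le> (\<integral>t. (t\<^sup>2 * indicator {t. \<bar>t\<bar> \<le> 2 * y} t - t\<^sup>2 * indicator {t. \<bar>t\<bar> \<le> y} t) / y \<partial>D)"
    proof (intro integral_mono Bochner_Integration.integrable_diff integrable_tail
        integrable_trunc integrable_divide)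
      fix t
      have "\<bar>t\<bar> \<le> t\<^sup>2 / y" if "\<bar>t\<bar> > y"
        using mult_left_mono[OF less_imp_le[OF that], of "\<bar>t\<bar>"] y
        by (simp add: le_divide_eq power2_eq_square)
      then show "\<bar>t\<bar> * indicator {t. \<bar>t\<bar> > y} t - \<bar>t\<bar> * indicator {t. \<bar>t\<bar> > 2 * y} t
          \<le> (t\<^sup>2 * indicator {t. \<bar>t\<bar> \<le> 2 * y} t - t\<^sup>2 * indicator {t. \<bar>t\<bar> \<le> y} t) / y"
        using y by (auto simp: indicator_def)
    qed
    also have "\<dots> = (V (2 * y) - V y) / y"
      unfolding trunc_second_moment_def by (simp add: integrable_trunc)
    also have "\<dots> \<le> \<eta> * V y / y"
      using R(2)[OF that] y by (intro divide_right_mono) (auto simp: algebra_simps)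
    finally have "U y - U (2 * y) \<le> \<eta> * V y / y" .
    moreover have "4 * \<eta> * V (2 * y) / (2 * y) \<le> 3 * \<eta> * V y / y"
    proof -
      have "V (2 * y) \<le> 3 / 2 * V y"
        using R(2)[OF that] mult_right_mono[OF \<eta>(2) trunc_second_moment_nonneg[of D y]]
        by (simp add: algebra_simps)
      then have "2 * \<eta> * V (2 * y) \<le> 2 * \<eta> * (3 / 2 * V y)"
        using \<eta> by (intro mult_left_mono) auto
      then have "2 * \<eta> * V (2 * y) / y \<le> 3 * \<eta> * V y / y"
        using y by (intro divide_right_mono) auto
      then show ?thesis
        using y by simp
    qed
    ultimately show ?thesis
      unfolding g_def by simp
  qed
  have "g y \<le> 0" if y: "y \<ge> R" for y
  proof -
    have le: "g y \<le> U (2 ^ k * y)" for k :: nat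
    proof -
      have "g y \<le> g (2 ^ k * y) \<and> R \<le> 2 ^ k * y"
      proof (induction k)
        case (Suc k)
        then show ?case
          using step[of "2 ^ k * y"] R(1) by (auto simp: mult.assoc)
      qed (use y in simp)
      moreover have "g (2 ^ k * y) \<le> U (2 ^ k * y)"
        using y R(1) \<eta> trunc_second_moment_nonneg[of D] by (simp add: g_def)
      ultimately show ?thesis
        by linarith
    qed
    have "filterlim (\<lambda>k::nat. 2 ^ k * y) at_top sequentially"
      using y R filterlim_tendsto_pos_mult_at_top[OF tendsto_const, of y "\<lambda>k. 2 ^ k" sequentially]
        filterlim_at_infinity_imp_filterlim_at_top[OF filterlim_realpow_sequentially_gt1[of "2::real"]]
      by (simp add: mult.commute)
    then have "(\<lambda>k. U (2 ^ k * y)) \<longlonglongrightarrow> 0"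
      by (rule filterlim_compose[OF U_tendsto_0])
    then show ?thesis
      using le by (intro tendsto_lowerbound) auto
  qed
  then have "U y \<le> d * V y / y" if "y \<ge> R" for y
  proof -
    have "4 * \<eta> * V y / y \<le> d * V y / y"
      using \<eta> that R trunc_second_moment_nonneg[of D] by (intro divide_right_mono mult_right_mono) auto
    with \<open>\<And>y. y \<ge> R \<Longrightarrow> g y \<le> 0\<close>[OF that] show ?thesis
      by (simp add: g_def)
  qed
  then show ?thesis
    unfolding eventually_at_top_linorder by auto
qed

end

text \<open>Take the least exponent reaching x; by minimality the previous power falls short, which
  is the second bound. It converts iterated doubling estimates into powers of x / z.\<close>

lemma doubling_exponent:
  fixes z x :: real
  assumes "0 < z" "z \<le> x"
  shows "\<exists>k. x \<le> 2 ^ k * z \<and> 2 ^ k \<le> 2 * (x / z)"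
proof -
  define P where "P k \<longleftrightarrow> x \<le> 2 ^ k * z" for k :: nat
  obtain n where "x / z < 2 ^ n"
    using real_arch_pow[of 2 "x / z"] by auto
  then have "P n"
    using assms by (simp add: P_def field_simps)
  define k where "k = (LEAST k. P k)"
  have "P k"
    unfolding k_def using \<open>P n\<close> by (rule LeastI)
  moreover have "2 ^ k \<le> 2 * (x / z)"
  proof (cases k)
    case (Suc j)
    then have "\<not> P j"
      unfolding k_def using not_less_Least[of j P] by auto
    with Suc show ?thesis
      using assms by (simp add: P_def field_simps)
  qed (use assms in \<open>simp add: field_simps\<close>)
  ultimately show ?thesis
    unfolding P_def by blast
qed

context centered_law
begin

text \<open>Slow variation is applied in the crude form V(2 y) <= 2 V(y), so V(y) / y does not grow
  along doublings; rounding z up to the next 2^k y costs the factor 2.\<close>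

lemma V_over_quasi_decreasing:
  assumes "slowly_varying V"
  shows "\<forall>\<^sub>F y in at_top. \<forall>z\<ge>y. V z / z \<le> 2 * (V y / y)"
proof -
  obtain R where R: "R > 0" "\<And>y. y \<ge> R \<Longrightarrow> V (2 * y) \<le> 2 * V y"
    by (rule eventually_at_top_posE[OF V_double[OF assms zero_less_one]]) auto
  have "V z / z \<le> 2 * (V y / y)" if yz: "y \<ge> R" "z \<ge> y" for y z
  proof -
    have it: "V (2 ^ k * y) \<le> 2 ^ k * V y" for k :: nat
    proof (induction k)
      case (Suc k)
      have "R \<le> 2 ^ k * y"
        using that R mult_right_mono[OF one_le_power[of "2::real" k], of y]
        by (auto intro: order.trans)
      from R(2)[OF this] Suc show ?case
        by (simp add: mult.assoc)
    qed simp
    obtain k where k: "z \<le> 2 ^ k * y" "2 ^ k \<le> 2 * (z / y)"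
      using doubling_exponent[OF less_le_trans[OF R(1) yz(1)] yz(2)] by blast
    have "V z \<le> 2 ^ k * V y"
      using V_mono[OF k(1)] it[of k] by linarith
    also have "\<dots> \<le> 2 * (z / y) * V y"
      using k(2) trunc_second_moment_nonneg by (rule mult_right_mono)
    finally show ?thesis
      using that R by (simp add: field_simps)
  qed
  then show ?thesis
    unfolding eventually_at_top_linorder by blast
qed

end

text \<open>Iteration gives G(z) <= 2^m G(c^m z). With c^p > 2, p such steps cover one doubling at
  the price 2^p, so k doublings cost (2^k)^p, and 2^k is at most 2 x / z.\<close>

lemma power_bound_of_doubling:
  fixes G :: "real \<Rightarrow> real"
  assumes "antimono G" "\<And>x. 0 \<le> G x" and c: "c > 1"
    and dom: "\<forall>\<^sub>F x in at_top. G x \<le> 2 * G (c * x)"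
  obtains p :: nat and R where "R > 0" "\<And>z x. R \<le> z \<Longrightarrow> z \<le> x \<Longrightarrow> G z \<le> (2 * (x / z)) ^ p * G x"
proof -
  obtain R where R: "R > 0" "\<And>x. x \<ge> R \<Longrightarrow> G x \<le> 2 * G (c * x)"
    by (rule eventually_at_top_posE[OF dom]) blast
  obtain p where p: "2 < c ^ p"
    using real_arch_pow[OF c] by auto
  have it: "G z \<le> 2 ^ m * G (c ^ m * z)" if "z \<ge> R" for z and m :: nat
  proof (induction m)
    case (Suc m)
    have "1 \<le> c ^ m"
      using c by simp
    then have "R \<le> c ^ m * z"
      using that R mult_right_mono[of 1 "c ^ m" z] by (auto intro: order.trans)
    from R(2)[OF this] have "2 ^ m * G (c ^ m * z) \<le> 2 ^ m * (2 * G (c * (c ^ m * z)))"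
      by (intro mult_left_mono) auto
    with Suc have "G z \<le> 2 ^ m * (2 * G (c * (c ^ m * z)))"
      by linarith
    then show ?case
      by (simp add: mult_ac)
  qed simp
  have "G z \<le> (2 * (x / z)) ^ p * G x" if zx: "R \<le> z" "z \<le> x" for z x
  proof -
    obtain k where k: "x \<le> 2 ^ k * z" "2 ^ k \<le> 2 * (x / z)"
      using doubling_exponent[OF less_le_trans[OF R(1) zx(1)] zx(2)] by blast
    have "x \<le> c ^ (p * k) * z"
    proof (rule order.trans[OF k(1)])
      have "(2::real) ^ k \<le> (c ^ p) ^ k"
        using p by (intro power_mono) auto
      then show "2 ^ k * z \<le> c ^ (p * k) * z"
        using that R by (simp add: power_mult mult_right_mono)
    qed
    have "G z \<le> 2 ^ (p * k) * G (c ^ (p * k) * z)"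
      by (rule it[OF that(1)])
    also have "\<dots> \<le> 2 ^ (p * k) * G x"
      using antimonoD[OF assms(1) \<open>x \<le> c ^ (p * k) * z\<close>] by (intro mult_left_mono) auto
    also have "\<dots> = (2 ^ k) ^ p * G x"
      by (metis mult.commute power_mult)
    also have "\<dots> \<le> (2 * (x / z)) ^ p * G x"
      using k(2) assms(2) by (intro mult_right_mono power_mono) auto
    finally show ?thesis .
  qed
  with R(1) that show ?thesis
    by blast
qed

context centered_law
begin

lemma tail_prob_le:
  assumes "y > 0"
  shows "measure D {t. \<bar>t\<bar> > y} \<le> U y / y"
proof -
  have "y * measure D {t. \<bar>t\<bar> > y} = (\<integral>t. y * indicator {t. \<bar>t\<bar> > y} t \<partial>D)"
    by simp
  also have "\<dots> \<le> U y"
    unfolding tail_moment_def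
    using assms by (intro integral_mono[OF _ integrable_tail] integrable_mult_right integrable_real_indicator)
      (auto simp: indicator_def less_top[symmetric])
  finally show ?thesis
    using assms by (simp add: field_simps)
qed

lemma G_le_U:
  assumes "y > 0"
  shows "G y \<le> U y / y"
proof -
  have "G y \<le> measure D {t. \<bar>t\<bar> > y}"
    unfolding upper_tail_def by (rule finite_measure_mono) auto
  with tail_prob_le[OF assms] show ?thesis
    by linarith
qed

end

section \<open>Sums of truncated summands\<close>

text \<open>The index set is all of \<open>nat\<close>, so that \<open>Y n\<close> is always a
  summand outside \<open>{..<n}\<close>.\<close>

locale iid_sample = prob_space M + law: centered_law D
  for M :: "'a measure" and D :: "real measure" +
  fixes Y :: "nat \<Rightarrow> 'a \<Rightarrow> real"
  assumes indep: "indep_vars (\<lambda>_. borel) Y UNIV"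
    and distr_Y: "distr M borel (Y i) = D"
begin

abbreviation "V \<equiv> trunc_second_moment D"
abbreviation "U \<equiv> tail_moment D"
abbreviation "G \<equiv> upper_tail D"

lemma measurable_Y [measurable]: "Y i \<in> borel_measurable M"
  using indep by (auto simp: indep_vars_def)

lemma prob_Y:
  assumes "A \<in> sets borel"
  shows "prob {\<omega>\<in>space M. Y i \<omega> \<in> A} = measure D A"
proof -
  have "measure D A = prob (Y i -` A \<inter> space M)"
    using measure_distr[OF measurable_Y assms] distr_Y by simp
  also have "Y i -` A \<inter> space M = {\<omega>\<in>space M. Y i \<omega> \<in> A}"
    by auto
  finally show ?thesis
    by simp
qed

lemma prob_Y_greater: "prob {\<omega>\<in>space M. Y i \<omega> > y} = G y"
  using prob_Y[of "{y<..}" i] by (simp add: upper_tail_def)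

lemma expectation_Y:
  fixes f :: "real \<Rightarrow> real"
  assumes "f \<in> borel_measurable borel"
  shows "expectation (\<lambda>\<omega>. f (Y i \<omega>)) = (\<integral>t. f t \<partial>D)"
  using integral_distr[OF measurable_Y, of f i] assms distr_Y by simp

lemma expectation_prod_Y:
  fixes f :: "nat \<Rightarrow> real \<Rightarrow> real"
  assumes J: "finite J"
    and f: "\<And>j. j \<in> J \<Longrightarrow> f j \<in> borel_measurable borel" "\<And>j t. j \<in> J \<Longrightarrow> \<bar>f j t\<bar> \<le> B"
  shows "expectation (\<lambda>\<omega>. \<Prod>j\<in>J. f j (Y j \<omega>)) = (\<Prod>j\<in>J. \<integral>t. f j t \<partial>D)"
    and "integrable M (\<lambda>\<omega>. \<Prod>j\<in>J. f j (Y j \<omega>))"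
proof -
  have ind: "indep_vars (\<lambda>_. borel) (\<lambda>j \<omega>. f j (Y j \<omega>)) J"
    by (rule indep_vars_compose2[OF indep_vars_subset[OF indep subset_UNIV] f(1)])
  have int: "integrable M (\<lambda>\<omega>. f j (Y j \<omega>))" if "j \<in> J" for j
    using that measurable_compose[OF measurable_Y f(1)] f(2)
    by (intro integrable_const_bound[where B = B]) auto
  show "integrable M (\<lambda>\<omega>. \<Prod>j\<in>J. f j (Y j \<omega>))"
    by (rule indep_vars_integrable[OF J ind int])
  have "expectation (\<lambda>\<omega>. \<Prod>j\<in>J. f j (Y j \<omega>)) = (\<Prod>j\<in>J. expectation (\<lambda>\<omega>. f j (Y j \<omega>)))"
    by (rule indep_vars_lebesgue_integral[OF J ind int])
  also have "\<dots> = (\<Prod>j\<in>J. \<integral>t. f j t \<partial>D)"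
    using f(1) by (intro prod.cong refl expectation_Y) auto
  finally show "expectation (\<lambda>\<omega>. \<Prod>j\<in>J. f j (Y j \<omega>)) = (\<Prod>j\<in>J. \<integral>t. f j t \<partial>D)" .
qed

text \<open>The Chernoff bound with parameter \<open>k / y\<close>; the sign \<open>s\<close> covers both tails, and \<open>Y i\<close> is a
  further summand not entering the sum.\<close>
lemma truncated_sum_tail:
  fixes s t y k :: real
  assumes I: "finite I" "i \<notin> I" "card I \<le> n"
    and A [measurable]: "A \<in> sets borel" and yk: "y > 0" "k \<ge> 0" and s: "s = 1 \<or> s = -1"
  shows "prob {\<omega>\<in>space M. Y i \<omega> \<in> A \<and> (\<forall>j\<in>I. s * Y j \<omega> \<le> y) \<and> t \<le> s * (\<Sum>j\<in>I. Y j \<omega>)}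
    \<le> measure D A * exp (- (k * t / y) + real n * (k * U y / y + k\<^sup>2 * exp k * V y / y\<^sup>2))"
    (is "prob ?E \<le> _ * exp (_ + real n * ?q)")
proof -
  define \<phi> where "\<phi> u = exp (k * (s * u) / y) * indicator {u. s * u \<le> y} u" for u :: real
  \<comment> \<open>Giving index i the indicator of \<open>A\<close> and all others the truncated
    exponential lets a single product formula over \<open>insert i I\<close> handle the extra event
    as well.\<close>
  define f where "f j = (if j = i then indicator A else \<phi>)" for j
  have q: "?q \<ge> 0"
    using yk tail_moment_nonneg[of D y] trunc_second_moment_nonneg[of D y] by simp
  have \<phi>_meas [measurable]: "\<phi> \<in> borel_measurable borel"
    unfolding \<phi>_def[abs_def] by measurable
  have f_meas: "f j \<in> borel_measurable borel" for j
    using A by (auto simp: f_def)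
  have \<phi>_bound: "0 \<le> \<phi> u" "\<phi> u \<le> exp k" for u
  proof -
    have "k * (s * u) / y \<le> k" if "s * u \<le> y"
      using mult_left_mono[OF that yk(2)] yk(1) by (simp add: divide_le_eq)
    then show "0 \<le> \<phi> u" "\<phi> u \<le> exp k"
      by (auto simp: \<phi>_def indicator_def)
  qed
  have f_bound: "\<bar>f j u\<bar> \<le> exp k" for j u
    using \<phi>_bound[of u] yk(2) by (auto simp: f_def indicator_def)
  have "prob ?E = expectation (indicator ?E)"
    by (simp add: Int_absorb2 Collect_mono)
  also have "\<dots> \<le> expectation (\<lambda>\<omega>. exp (- (k * t / y)) * (\<Prod>j\<in>insert i I. f j (Y j \<omega>)))"
  proof (rule integral_mono)
    show "integrable M (indicator ?E :: 'a \<Rightarrow> real)"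
      using I by (intro integrable_real_indicator) (auto simp: less_top[symmetric])
    show "integrable M (\<lambda>\<omega>. exp (- (k * t / y)) * (\<Prod>j\<in>insert i I. f j (Y j \<omega>)))"
      using I f_meas f_bound by (intro integrable_mult_right expectation_prod_Y(2)) auto
    fix \<omega> assume "\<omega> \<in> space M"
    have split: "(\<Prod>j\<in>insert i I. f j (Y j \<omega>)) = indicator A (Y i \<omega>) * (\<Prod>j\<in>I. \<phi> (Y j \<omega>))"
      using I by (auto simp: f_def intro!: prod.cong)
    show "indicator ?E \<omega> \<le> exp (- (k * t / y)) * (\<Prod>j\<in>insert i I. f j (Y j \<omega>))"
    proof (cases "\<omega> \<in> ?E")
      case True
      have "(\<Prod>j\<in>I. \<phi> (Y j \<omega>)) = (\<Prod>j\<in>I. exp (k * (s * Y j \<omega>) / y))"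
        using True by (intro prod.cong) (auto simp: \<phi>_def)
      also have "\<dots> = exp (k * (s * (\<Sum>j\<in>I. Y j \<omega>)) / y)"
        using I by (simp add: exp_sum sum_distrib_left sum_divide_distrib)
      finally have "exp (- (k * t / y)) * (\<Prod>j\<in>insert i I. f j (Y j \<omega>))
          = exp (k * (s * (\<Sum>j\<in>I. Y j \<omega>)) / y - k * t / y)"
        using True unfolding split by (simp add: exp_diff exp_minus field_simps)
      moreover have "k * t / y \<le> k * (s * (\<Sum>j\<in>I. Y j \<omega>)) / y"
        using True yk by (intro divide_right_mono mult_left_mono) auto
      ultimately show ?thesis
        using True by simp
    next
      case False
      then show ?thesis
        using \<phi>_bound(1) unfolding split by (auto intro!: mult_nonneg_nonneg prod_nonneg)
    qed
  qed
  also have "\<dots> = exp (- (k * t / y)) * (\<Prod>j\<in>insert i I. \<integral>u. f j u \<partial>D)"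
    using I f_meas f_bound by (subst integral_mult_right_zero, subst expectation_prod_Y(1)) auto
  also have "(\<Prod>j\<in>insert i I. \<integral>u. f j u \<partial>D) = measure D A * (\<integral>u. \<phi> u \<partial>D) ^ card I"
  proof -
    have "(\<Prod>j\<in>I. \<integral>u. f j u \<partial>D) = (\<Prod>j\<in>I. \<integral>u. \<phi> u \<partial>D)"
      using I by (intro prod.cong) (auto simp: f_def)
    then show ?thesis
      using I A by (simp add: f_def)
  qed
  also have "exp (- (k * t / y)) * (measure D A * (\<integral>u. \<phi> u \<partial>D) ^ card I)
      \<le> exp (- (k * t / y)) * (measure D A * exp (real n * ?q))"
  proof (intro mult_left_mono)
    have "(\<integral>u. \<phi> u \<partial>D) \<le> 1 + ?q"
      using law.truncated_mgf_le[OF yk s] by (simp add: \<phi>_def[abs_def] add.assoc)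
    also have "\<dots> \<le> exp ?q"
      by (rule exp_ge_add_one_self)
    finally have "(\<integral>u. \<phi> u \<partial>D) ^ card I \<le> exp ?q ^ card I"
      using \<phi>_bound by (intro power_mono integral_nonneg_AE) auto
    also have "\<dots> = exp (real (card I) * ?q)"
      by (rule exp_of_nat_mult[symmetric])
    also have "\<dots> \<le> exp (real n * ?q)"
      using I(3) q by (simp add: mult_right_mono)
    finally show "(\<integral>u. \<phi> u \<partial>D) ^ card I \<le> exp (real n * ?q)" .
  qed auto
  also have "\<dots> = measure D A * exp (- (k * t / y) + real n * ?q)"
    unfolding exp_add by (simp only: mult_ac)
  finally show ?thesis .
qed

lemma prob_Y_and_sum:
  assumes "finite I" "i \<notin> I" "A \<in> sets borel" "B \<in> sets borel"
  shows "prob {\<omega>\<in>space M. Y i \<omega> \<in> A \<and> (\<Sum>j\<in>I. Y j \<omega>) \<in> B}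
    = measure D A * prob {\<omega>\<in>space M. (\<Sum>j\<in>I. Y j \<omega>) \<in> B}"
proof -
  have "indep_vars (\<lambda>_. borel) Y (insert i I)"
    using assms by (intro indep_vars_subset[OF indep]) auto
  then have "indep_var borel (Y i) borel (\<lambda>\<omega>. \<Sum>j\<in>I. Y j \<omega>)"
    using assms by (intro indep_vars_sum) auto
  from indep_varD[OF this assms(3,4)]
  have "prob ((\<lambda>\<omega>. (Y i \<omega>, \<Sum>j\<in>I. Y j \<omega>)) -` (A \<times> B) \<inter> space M)
    = prob (Y i -` A \<inter> space M) * prob ((\<lambda>\<omega>. \<Sum>j\<in>I. Y j \<omega>) -` B \<inter> space M)" .
  moreover have "(\<lambda>\<omega>. (Y i \<omega>, \<Sum>j\<in>I. Y j \<omega>)) -` (A \<times> B) \<inter> space M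
      = {\<omega>\<in>space M. Y i \<omega> \<in> A \<and> (\<Sum>j\<in>I. Y j \<omega>) \<in> B}"
    "Y i -` A \<inter> space M = {\<omega>\<in>space M. Y i \<omega> \<in> A}"
    "(\<lambda>\<omega>. \<Sum>j\<in>I. Y j \<omega>) -` B \<inter> space M = {\<omega>\<in>space M. (\<Sum>j\<in>I. Y j \<omega>) \<in> B}"
    by auto
  ultimately show ?thesis
    using prob_Y[OF assms(3)] by simp
qed

lemma prob_Y_greater_pair:
  assumes "i \<noteq> j"
  shows "prob {\<omega>\<in>space M. Y i \<omega> > u \<and> Y j \<omega> > u} = G u * G u"
  using prob_Y_and_sum[of "{j}" i "{u<..}" "{u<..}"] prob_Y_greater[of u j] assms
  by (simp add: upper_tail_def)

text \<open>Truncate at \<open>x n\<close> itself. The Chernoff exponent is - k \<epsilon> + (k +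
  k^2 exp(k)) v with v = n V(x) / x^2 tending to 0, so a large fixed k suffices; summands beyond
  \<open>x n\<close> cost at most v. The bound depends on n only, hence is uniform in
  \<open>I\<close>; this is needed because the jump estimates remove one summand.\<close>

lemma weak_law:
  assumes sv: "slowly_varying V" and x: "filterlim x at_top sequentially"
    and var: "(\<lambda>n. real n * V (x n) / (x n)\<^sup>2) \<longlonglongrightarrow> 0"
    and "\<epsilon> > 0" "\<delta> > 0" and s: "s = 1 \<or> s = -1"
  shows "\<forall>\<^sub>F n in sequentially. \<forall>I\<subseteq>{..<n}. prob {\<omega>\<in>space M. \<epsilon> * x n \<le> s * (\<Sum>j\<in>I. Y j \<omega>)} \<le> \<delta>"
proof -
  obtain k where k: "k > 0" "exp (- (k * \<epsilon>)) < \<delta>"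
  proof -
    have "((\<lambda>k. exp (- (k * \<epsilon>))) \<longlongrightarrow> 0) at_top"
      using \<open>\<epsilon> > 0\<close> by real_asymp
    then have "\<forall>\<^sub>F k in at_top. exp (- (k * \<epsilon>)) < \<delta>"
      using \<open>\<delta> > 0\<close> by (rule order_tendstoD)
    then show ?thesis
      using that by (rule eventually_at_top_posE) auto
  qed
  define v where "v n = real n * V (x n) / (x n)\<^sup>2" for n
  define b where "b n = v n + exp (- (k * \<epsilon>) + (k + k\<^sup>2 * exp k) * v n)" for n
  have v: "v \<longlonglongrightarrow> 0"
    using var by (simp add: v_def[abs_def])
  have "b \<longlonglongrightarrow> 0 + exp (- (k * \<epsilon>) + (k + k\<^sup>2 * exp k) * 0)"
    unfolding b_def by (intro tendsto_intros v)
  then have b: "\<forall>\<^sub>F n in sequentially. b n < \<delta>"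
    using k by (auto intro: order_tendstoD)
  have U: "\<forall>\<^sub>F n in sequentially. U (x n) \<le> 1 * V (x n) / x n"
    using filterlim_iff[THEN iffD1, OF x] law.U_le_V[OF sv zero_less_one] by blast
  have pos: "\<forall>\<^sub>F n in sequentially. x n > 0"
    using x filterlim_at_top_dense by blast
  show ?thesis
    using b U pos
  proof eventually_elim
    case (elim n)
    show ?case
    proof (intro allI impI)
      fix I assume I: "I \<subseteq> {..<n}"
      then have I': "finite I" "n \<notin> I" "card I \<le> n"
        using card_mono[OF _ I] by (auto intro: finite_subset)
      \<comment> \<open>\<open>truncated_sum_tail\<close> asks for a further summand:
        \<open>Y n\<close> is outside \<open>I\<close>, and the condition \<open>UNIV\<close>
        imposed on it is void.\<close>
      let ?B = "{\<omega>\<in>space M. Y n \<omega> \<in> UNIV \<and> (\<forall>j\<in>I. s * Y j \<omega> \<le> x n) \<and> \<epsilon> * x n \<le> s * (\<Sum>j\<in>I. Y j \<omega>)}"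
      let ?A = "\<lambda>j. {\<omega>\<in>space M. Y j \<omega> \<in> {t. \<bar>t\<bar> > x n}}"
      have A: "prob (?A j) \<le> V (x n) / (x n)\<^sup>2" for j
      proof -
        have "prob (?A j) \<le> U (x n) / x n"
          using law.tail_prob_le[OF elim(3)] prob_Y[of "{t. \<bar>t\<bar> > x n}" j] by simp
        also have "\<dots> \<le> (V (x n) / x n) / x n"
          using elim by (intro divide_right_mono) auto
        finally show ?thesis
          by (simp add: power2_eq_square)
      qed
      have [measurable]: "?B \<in> events"
        using I' by measurable
      have "prob {\<omega>\<in>space M. \<epsilon> * x n \<le> s * (\<Sum>j\<in>I. Y j \<omega>)} \<le> prob (?B \<union> (\<Union>j\<in>I. ?A j))"
        using I' elim s by (intro finite_measure_mono) (auto simp: not_le)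
      also have "\<dots> \<le> prob ?B + prob (\<Union>j\<in>I. ?A j)"
        using I' by (intro measure_Un_le) auto
      also have "prob (\<Union>j\<in>I. ?A j) \<le> (\<Sum>j\<in>I. prob (?A j))"
        using I' by (intro measure_UNION_le) auto
      also have "\<dots> \<le> real (card I) * (V (x n) / (x n)\<^sup>2)"
        using A by (rule sum_bounded_above)
      also have "\<dots> \<le> real n * (V (x n) / (x n)\<^sup>2)"
        using I' trunc_second_moment_nonneg[of D] by (intro mult_right_mono) auto
      also have "\<dots> = v n"
        by (simp add: v_def)
      also have "prob ?B \<le> measure D UNIV * exp (- (k * (\<epsilon> * x n) / x n)
          + real n * (k * U (x n) / x n + k\<^sup>2 * exp k * V (x n) / (x n)\<^sup>2))"
        using I' elim k s by (intro truncated_sum_tail) auto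
      also have "\<dots> \<le> exp (- (k * \<epsilon>) + (k + k\<^sup>2 * exp k) * v n)"
      proof -
        have "k * U (x n) / x n \<le> k * (V (x n) / x n) / x n"
          using elim k by (intro divide_right_mono mult_left_mono) auto
        then have "real n * (k * U (x n) / x n + k\<^sup>2 * exp k * V (x n) / (x n)\<^sup>2)
            \<le> real n * (k * (V (x n) / x n) / x n + k\<^sup>2 * exp k * V (x n) / (x n)\<^sup>2)"
          by (intro mult_left_mono add_right_mono) auto
        also have "\<dots> = (k + k\<^sup>2 * exp k) * v n"
          using elim by (simp add: v_def power2_eq_square field_simps)
        finally show ?thesis
          using elim law.prob_space by simp
      qed
      finally have "prob {\<omega>\<in>space M. \<epsilon> * x n \<le> s * (\<Sum>j\<in>I. Y j \<omega>)} \<le> b n"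
        by (simp add: b_def)
      with elim show "prob {\<omega>\<in>space M. \<epsilon> * x n \<le> s * (\<Sum>j\<in>I. Y j \<omega>)} \<le> \<delta>"
        by linarith
    qed
  qed
qed

end

section \<open>One big jump\<close>

context iid_sample
begin

section \<open>Estimates for fixed n, by the size of the jump\<close>

lemma prob_exists_le:
  assumes "\<And>i. i < n \<Longrightarrow> {\<omega>\<in>space M. P i \<omega>} \<in> events"
    and "\<And>i. i < n \<Longrightarrow> prob {\<omega>\<in>space M. P i \<omega>} \<le> c"
  shows "prob {\<omega>\<in>space M. \<exists>i<n. P i \<omega>} \<le> real n * c"
proof -
  have "{\<omega>\<in>space M. \<exists>i<n. P i \<omega>} = (\<Union>i\<in>{..<n}. {\<omega>\<in>space M. P i \<omega>})"
    by auto
  then have "prob {\<omega>\<in>space M. \<exists>i<n. P i \<omega>} \<le> (\<Sum>i<n. prob {\<omega>\<in>space M. P i \<omega>})"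
    using assms(1) measure_UNION_le[of "{..<n}" "\<lambda>i. {\<omega>\<in>space M. P i \<omega>}" M] by simp
  also have "\<dots> \<le> real n * c"
    using sum_bounded_above[of "{..<n}" "\<lambda>i. prob {\<omega>\<in>space M. P i \<omega>}" c] assms(2) by simp
  finally show ?thesis .
qed

lemma prob_exists_Y_greater_le: "prob {\<omega>\<in>space M. \<exists>i<n. Y i \<omega> > u} \<le> real n * G u"
  by (rule prob_exists_le) (simp_all add: prob_Y_greater)

lemma sum_diff_Y: "i < n \<Longrightarrow> (\<Sum>j\<in>{..<n} - {i}. Y j \<omega>) = (\<Sum>j<n. Y j \<omega>) - Y i \<omega>"
  by (simp add: sum_diff1)

text \<open>A summand of intermediate size leaves a macroscopic deviation to the remaining ones.\<close>
lemma prob_intermediate_jump_le: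
  assumes \<beta>: "\<forall>I\<subseteq>{..<n}. prob {\<omega>\<in>space M. \<epsilon> * x \<le> (\<Sum>j\<in>I. Y j \<omega>)} \<le> \<beta>"
  shows "prob {\<omega>\<in>space M. x \<le> (\<Sum>j<n. Y j \<omega>) \<and> (\<exists>i<n. \<epsilon> * x < Y i \<omega> \<and> Y i \<omega> \<le> (1 - \<epsilon>) * x)}
    \<le> real n * (G (\<epsilon> * x) * \<beta>)"
proof -
  have "prob {\<omega>\<in>space M. x \<le> (\<Sum>j<n. Y j \<omega>) \<and> (\<exists>i<n. \<epsilon> * x < Y i \<omega> \<and> Y i \<omega> \<le> (1 - \<epsilon>) * x)}
      \<le> prob {\<omega>\<in>space M. \<exists>i<n. Y i \<omega> \<in> {\<epsilon> * x<..} \<and> (\<Sum>j\<in>{..<n} - {i}. Y j \<omega>) \<in> {\<epsilon> * x..}}"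
    by (intro finite_measure_mono) (auto simp: sum_diff_Y algebra_simps)
  also have "\<dots> \<le> real n * (G (\<epsilon> * x) * \<beta>)"
  proof (rule prob_exists_le)
    fix i assume "i < n"
    have "prob {\<omega>\<in>space M. Y i \<omega> \<in> {\<epsilon> * x<..} \<and> (\<Sum>j\<in>{..<n} - {i}. Y j \<omega>) \<in> {\<epsilon> * x..}}
        = G (\<epsilon> * x) * prob {\<omega>\<in>space M. \<epsilon> * x \<le> (\<Sum>j\<in>{..<n} - {i}. Y j \<omega>)}"
      by (subst prob_Y_and_sum) (auto simp: upper_tail_def)
    also have "\<dots> \<le> G (\<epsilon> * x) * \<beta>"
      using \<beta>[rule_format, of "{..<n} - {i}"] by (intro mult_left_mono upper_tail_nonneg) auto
    finally show "prob {\<omega>\<in>space M. Y i \<omega> \<in> {\<epsilon> * x<..} \<and> (\<Sum>j\<in>{..<n} - {i}. Y j \<omega>) \<in> {\<epsilon> * x..}}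
        \<le> G (\<epsilon> * x) * \<beta>" .
  qed measurable
  finally show ?thesis .
qed

text \<open>One summand above y / 2 is singled out. Being at most y <= x / 2, it leaves x / 2 to the
  others, and independence yields the product of G(y / 2) with the Chernoff bound. The factor G(y /
  2) is essential: the exponential alone would not compare with G(x).\<close>

lemma prob_level_jump_le:
  assumes y: "0 < y" "y \<le> x / 2" and k: "0 < k" "k \<le> 1" and L: "L * k \<le> 1 / 16"
    and U: "U y \<le> k * V y / y" and V: "real n * V y / y \<le> L * x"
  shows "prob {\<omega>\<in>space M. x \<le> (\<Sum>j<n. Y j \<omega>) \<and> (\<forall>j<n. Y j \<omega> \<le> y) \<and> (\<exists>i<n. Y i \<omega> > y / 2)}
    \<le> real n * (G (y / 2) * exp (- (k / 4 * (x / y))))"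
    (is "prob ?E \<le> _")
proof -
  let ?F = "\<lambda>i \<omega>. Y i \<omega> \<in> {y / 2<..} \<and> (\<forall>j\<in>{..<n} - {i}. 1 * Y j \<omega> \<le> y) \<and>
      x / 2 \<le> 1 * (\<Sum>j\<in>{..<n} - {i}. Y j \<omega>)"
  have "prob ?E \<le> prob {\<omega>\<in>space M. \<exists>i<n. ?F i \<omega>}"
  proof (rule finite_measure_mono)
    show "?E \<subseteq> {\<omega>\<in>space M. \<exists>i<n. ?F i \<omega>}"
    proof
      fix \<omega> assume \<omega>: "\<omega> \<in> ?E"
      then obtain i where i: "i < n" "Y i \<omega> > y / 2"
        by blast
      moreover have "x / 2 \<le> (\<Sum>j\<in>{..<n} - {i}. Y j \<omega>)"
        using \<omega> i y by (force simp: sum_diff_Y)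
      ultimately show "\<omega> \<in> {\<omega>\<in>space M. \<exists>i<n. ?F i \<omega>}"
        using \<omega> by auto
    qed
  qed measurable
  also have "\<dots> \<le> real n * (G (y / 2) * exp (- (k / 4 * (x / y))))"
  proof (rule prob_exists_le)
    fix i assume "i < n"
    then have "card ({..<n} - {i}) \<le> n"
      by simp
    then have "prob {\<omega>\<in>space M. ?F i \<omega>} \<le> measure D {y / 2<..} * exp (- (k * (x / 2) / y)
        + real n * (k * U y / y + k\<^sup>2 * exp k * V y / y\<^sup>2))"
      using y k by (intro truncated_sum_tail) auto
    also have "\<dots> \<le> G (y / 2) * exp (- (k / 4 * (x / y)))"
    proof -
      \<comment> \<open>The loss is n (1 + 3) k^2 V(y) / y^2, with 1 from the bound on
        \<open>U\<close> and 3 from exp(k) <= 3. It is at most 4 k (L k) x / y <= (k / 4) x / y,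
        half of the gain k x / (2 y).\<close>
      have "exp k \<le> exp 1"
        using k by simp
      also have "exp 1 \<le> (3::real)"
        using exp_le by simp
      finally have e: "k\<^sup>2 * exp k * V y / y\<^sup>2 \<le> k\<^sup>2 * 3 * V y / y\<^sup>2"
        using trunc_second_moment_nonneg[of D] by (intro divide_right_mono mult_right_mono mult_left_mono) auto
      have "k * U y / y \<le> k * (k * V y / y) / y"
        using U y k by (intro divide_right_mono mult_left_mono) auto
      also have "\<dots> = k\<^sup>2 * V y / y\<^sup>2"
        by (simp add: power2_eq_square)
      finally have kU: "k * U y / y \<le> k\<^sup>2 * V y / y\<^sup>2" .
      have "k * U y / y + k\<^sup>2 * exp k * V y / y\<^sup>2 \<le> k\<^sup>2 * 4 * V y / y\<^sup>2"
      proof -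
        have split: "k\<^sup>2 * 4 * V y / y\<^sup>2 = k\<^sup>2 * V y / y\<^sup>2 + k\<^sup>2 * 3 * V y / y\<^sup>2"
          by (simp add: add_divide_distrib[symmetric])
        show ?thesis
          unfolding split by (rule add_mono[OF kU e])
      qed
      then have "real n * (k * U y / y + k\<^sup>2 * exp k * V y / y\<^sup>2) \<le> real n * (k\<^sup>2 * 4 * V y / y\<^sup>2)"
        by (rule mult_left_mono) simp
      also have "\<dots> = 4 * k\<^sup>2 / y * (real n * V y / y)"
        by (simp add: power2_eq_square)
      also have "\<dots> \<le> 4 * k\<^sup>2 / y * (L * x)"
        using V y by (intro mult_left_mono) auto
      also have "\<dots> = (L * k) * (4 * k * x / y)"
        by (simp add: power2_eq_square)
      also have "\<dots> \<le> 1 / 16 * (4 * k * x / y)"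
        using L y k by (intro mult_right_mono) auto
      finally have "- (k * (x / 2) / y) + real n * (k * U y / y + k\<^sup>2 * exp k * V y / y\<^sup>2)
          \<le> - (k / 4 * (x / y))"
        by (simp add: field_simps)
      then show ?thesis
        by (simp add: upper_tail_def mult_left_mono)
    qed
    finally show "prob {\<omega>\<in>space M. ?F i \<omega>} \<le> G (y / 2) * exp (- (k / 4 * (x / y)))" .
  qed measurable
  finally show ?thesis .
qed

text \<open>Split by the dyadic block \<open>{z j / 2<..z j}\<close>, \<open>z j = \<epsilon> * x / 2 ^ j\<close>, containing the maximum.\<close>
lemma prob_small_jumps_le:
  assumes k: "0 < k" "k \<le> 1" "L * k \<le> 1 / 16" and "R > 0"
    and U: "\<And>y. y \<ge> R \<Longrightarrow> U y \<le> k * V y / y"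
    and G: "\<And>z x. R \<le> z \<Longrightarrow> z \<le> x \<Longrightarrow> G z \<le> (2 * (x / z)) ^ p * G x"
    and T: "\<And>t. t \<ge> T \<Longrightarrow> (4 * t) ^ p * exp (- (k / 4 * t)) \<le> 1 / t" "T > 0"
    and \<epsilon>: "0 < \<epsilon>" "\<epsilon> \<le> 1 / 2" "\<epsilon> \<le> 1 / T" and "x > 0"
    and \<rho>: "\<rho> \<ge> 2 * R" and V: "\<And>y. y \<ge> \<rho> \<Longrightarrow> real n * V y / y \<le> L * x"
  shows "prob {\<omega>\<in>space M. x \<le> (\<Sum>j<n. Y j \<omega>) \<and> (\<exists>i<n. Y i \<omega> > \<rho>) \<and> (\<forall>j<n. Y j \<omega> \<le> \<epsilon> * x)}
    \<le> 2 * \<epsilon> * (real n * G x)"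
    (is "prob ?E \<le> _")
proof -
  define z where "z j = \<epsilon> * x / 2 ^ j" for j :: nat
  have z0: "z 0 = \<epsilon> * x" and zS: "z (Suc j) = z j / 2" for j
    by (simp_all add: z_def)
  have "\<rho> > 0"
    using \<rho> \<open>R > 0\<close> by linarith
  \<comment> \<open>Blocks with j >= J lie below \<rho> and cannot contain a maximum exceeding
    \<rho>, so finitely many blocks remain.\<close>
  obtain J where "\<epsilon> * x / \<rho> < 2 ^ J"
    using real_arch_pow[of 2 "\<epsilon> * x / \<rho>"] by auto
  then have J: "z J < \<rho>"
    using \<open>\<rho> > 0\<close> by (simp add: z_def field_simps)
  have z_le: "z j \<le> z i" if "i \<le> j" for i j
    using \<epsilon> \<open>x > 0\<close> that by (auto simp: z_def intro!: divide_left_mono power_increasing)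
  define A where "A j = {\<omega>\<in>space M. x \<le> (\<Sum>j<n. Y j \<omega>) \<and> (\<forall>i<n. Y i \<omega> \<le> z j) \<and> (\<exists>i<n. Y i \<omega> > z j / 2)}" for j
  have A_events: "A j \<in> events" for j
    unfolding A_def by measurable
  have A_le: "prob (A j) \<le> (1 / 2) ^ j * (\<epsilon> * (real n * G x))" if "z j > \<rho>" for j
  proof -
    have y: "z j > 0"
      using that \<open>\<rho> > 0\<close> by linarith
    \<comment> \<open>Since t = 2^j / \<epsilon> >= T, the polynomial times the exponential is at
      most 1 / t = \<epsilon> / 2^j: a geometric series whose sum is at most 2 \<epsilon>.\<close>
    define t where "t = x / z j"
    have t: "t = 2 ^ j / \<epsilon>"
      using \<open>x > 0\<close> \<epsilon> by (simp add: t_def z_def)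
    have "z j \<le> x / 2"
      using z_le[of 0 j] mult_right_mono[OF \<epsilon>(2) less_imp_le[OF \<open>x > 0\<close>]] by (simp add: z0)
    have "1 / \<epsilon> \<le> t"
      unfolding t using \<epsilon> by (intro divide_right_mono) auto
    moreover have "T \<le> 1 / \<epsilon>"
      using \<epsilon> T(2) by (simp add: field_simps)
    ultimately have "T \<le> t"
      by linarith
    have "prob (A j) \<le> real n * (G (z j / 2) * exp (- (k / 4 * t)))"
      unfolding A_def t_def using that \<rho> \<open>R > 0\<close> \<open>z j \<le> x / 2\<close> k
      by (intro prob_level_jump_le[where L = L]) (auto intro!: U V)
    \<comment> \<open>The 4 t is 2 x / (z j / 2), and \<rho> >= 2 R puts z j / 2 in the range of the
      power bound for \<open>G\<close>.\<close>
    also have "\<dots> \<le> real n * (((4 * t) ^ p * G x) * exp (- (k / 4 * t)))"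
    proof (intro mult_left_mono mult_right_mono)
      show "G (z j / 2) \<le> (4 * t) ^ p * G x"
        using G[of "z j / 2" x] that \<rho> \<open>z j \<le> x / 2\<close> \<open>x > 0\<close> by (simp add: t_def)
    qed auto
    also have "\<dots> = real n * G x * ((4 * t) ^ p * exp (- (k / 4 * t)))"
      by (simp add: mult_ac)
    also have "\<dots> \<le> real n * G x * (1 / t)"
      using T(1)[OF \<open>T \<le> t\<close>] upper_tail_nonneg by (intro mult_left_mono mult_nonneg_nonneg) auto
    also have "\<dots> = (1 / 2) ^ j * (\<epsilon> * (real n * G x))"
      by (simp add: t power_divide)
    finally show ?thesis .
  qed
  have "?E \<subseteq> (\<Union>j\<in>{j. j < J \<and> z j > \<rho>}. A j)"
  proof
    fix \<omega> assume \<omega>: "\<omega> \<in> ?E"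
    define m where "m = Max ((\<lambda>i. Y i \<omega>) ` {..<n})"
    obtain i where i: "i < n" "Y i \<omega> > \<rho>"
      using \<omega> by blast
    have fin: "finite ((\<lambda>i. Y i \<omega>) ` {..<n})" "(\<lambda>i. Y i \<omega>) ` {..<n} \<noteq> {}"
      using i by auto
    have m_ge: "Y j \<omega> \<le> m" if "j < n" for j
      unfolding m_def using that by (intro Max_ge) auto
    obtain i' where i': "i' < n" "m = Y i' \<omega>"
      using Max_in[OF fin] unfolding m_def by auto
    have m: "\<rho> < m" "m \<le> \<epsilon> * x"
      using i m_ge[of i] i' \<omega> by auto
    define P where "P j \<longleftrightarrow> z (Suc j) < m" for j
    have "P J"
      using z_le[of J "Suc J"] J m by (simp add: P_def)
    define j where "j = (LEAST j. P j)"
    have "P j"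
      unfolding j_def using \<open>P J\<close> by (rule LeastI)
    have "m \<le> z j"
    proof (cases j)
      case (Suc l)
      then have "\<not> P l"
        unfolding j_def using not_less_Least[of l P] by auto
      with Suc show ?thesis
        by (simp add: P_def)
    qed (use m z0 in simp)
    then have "\<rho> < z j"
      using m by linarith
    then have "j < J"
      using z_le[of J j] J by (cases "j < J") auto
    moreover have "\<omega> \<in> A j"
      using \<omega> \<open>m \<le> z j\<close> \<open>P j\<close> i' m_ge by (auto simp: A_def P_def zS intro: order.trans)
    ultimately show "\<omega> \<in> (\<Union>j\<in>{j. j < J \<and> z j > \<rho>}. A j)"
      using \<open>\<rho> < z j\<close> by blast
  qed
  then have "prob ?E \<le> prob (\<Union>j\<in>{j. j < J \<and> z j > \<rho>}. A j)"
    using A_events by (intro finite_measure_mono) auto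
  also have "\<dots> \<le> (\<Sum>j\<in>{j. j < J \<and> z j > \<rho>}. prob (A j))"
    using A_events by (intro measure_UNION_le) auto
  also have "\<dots> \<le> (\<Sum>j\<in>{j. j < J \<and> z j > \<rho>}. (1 / 2) ^ j * (\<epsilon> * (real n * G x)))"
    by (intro sum_mono A_le) auto
  also have "\<dots> \<le> (\<Sum>j<J. (1 / 2) ^ j * (\<epsilon> * (real n * G x)))"
    using \<epsilon> upper_tail_nonneg[of D] by (intro sum_mono2) auto
  also have "\<dots> = (\<Sum>j<J. (1 / 2) ^ j) * (\<epsilon> * (real n * G x))"
    by (rule sum_distrib_right[symmetric])
  also have "\<dots> \<le> 2 * (\<epsilon> * (real n * G x))"
  proof (rule mult_right_mono)
    show "(\<Sum>j<J. (1 / 2) ^ j) \<le> (2::real)"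
      by (simp add: sum_gp_strict)
  qed (use \<epsilon> upper_tail_nonneg[of D] in auto)
  finally show ?thesis
    by (simp add: mult.assoc)
qed

end

lemma eventually_power_exp_le_inverse:
  fixes k :: real
  assumes "k > 0"
  shows "\<forall>\<^sub>F t in at_top. (4 * t) ^ p * exp (- (k / 4 * t)) \<le> 1 / t"
proof -
  \<comment> \<open>Chosen so that C (k t / 4)^(p + 1) = (4 t)^p t.\<close>
  define C where "C = (16 / k) ^ p * (4 / k)"
  have "filterlim (\<lambda>t. k / 4 * t) at_top at_top"
    using assms by (intro filterlim_tendsto_pos_mult_at_top[OF tendsto_const] filterlim_ident) auto
  then have "((\<lambda>t. (k / 4 * t) ^ Suc p / exp (k / 4 * t)) \<longlongrightarrow> 0) at_top"
    by (rule filterlim_compose[OF tendsto_power_div_exp_0])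
  then have "((\<lambda>t. C * ((k / 4 * t) ^ Suc p / exp (k / 4 * t))) \<longlongrightarrow> 0) at_top"
    by (rule tendsto_mult_right_zero)
  then have "\<forall>\<^sub>F t in at_top. C * ((k / 4 * t) ^ Suc p / exp (k / 4 * t)) < 1"
    by (rule order_tendstoD) simp
  then show ?thesis
    using eventually_gt_at_top[of 0]
  proof eventually_elim
    case (elim t)
    have "C * ((k / 4 * t) ^ Suc p / exp (k / 4 * t)) = ((16 / k) * (k / 4 * t)) ^ p * ((4 / k) * (k / 4 * t)) * exp (- (k / 4 * t))"
      unfolding C_def power_mult_distrib power_Suc exp_minus by (simp add: field_simps)
    also have "\<dots> = (4 * t) ^ p * t * exp (- (k / 4 * t))"
      using assms by simp
    finally have eq: "C * ((k / 4 * t) ^ Suc p / exp (k / 4 * t)) = (4 * t) ^ p * t * exp (- (k / 4 * t))" .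
    have "(4 * t) ^ p * exp (- (k / 4 * t)) * t \<le> 1"
      using less_imp_le[OF elim(1)[unfolded eq]] by (simp only: mult_ac)
    then show ?case
      using pos_le_divide_eq[OF elim(2)] by blast
  qed
qed

text \<open>\<open>irv\<close> expresses the lower limit of intermediate regular variation without
  limits or quotients; for a decreasing function this form survives the shift by the mean.
  Positivity of \<open>G\<close> everywhere follows from eventual positivity by
  monotonicity.\<close>

locale regular_sample = iid_sample +
  assumes slow: "slowly_varying V"
    and G_pos: "0 < G u"
    and irv: "e > 0 \<Longrightarrow> \<exists>c>1. \<forall>\<^sub>F u in at_top. G u \<le> (1 + e) * G (c * u)"
begin

section \<open>Asymptotic upper and lower bounds for one big jump\<close>

lemma G_power_bound:
  "\<exists>p R. R > 0 \<and> (\<forall>z u. R \<le> z \<longrightarrow> z \<le> u \<longrightarrow> G z \<le> (2 * (u / z)) ^ p * G u)"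
proof -
  obtain c where c: "c > 1" "\<forall>\<^sub>F u in at_top. G u \<le> 2 * G (c * u)"
    using irv[of 1] by auto
  have "antimono G"
    using law.G_antimono by (rule antimonoI)
  then show ?thesis
    using power_bound_of_doubling[OF _ upper_tail_nonneg c] by metis
qed

text \<open>By Markov's inequality and U(x) <= V(x) / x, G(x) <= V(x) / x^2. The limit makes a
  second jump negligible in the lower bound.\<close>

lemma n_G_tendsto_0:
  assumes x: "filterlim x at_top sequentially"
    and var: "(\<lambda>n. real n * V (x n) / (x n)\<^sup>2) \<longlonglongrightarrow> 0"
  shows "(\<lambda>n. real n * G (x n)) \<longlonglongrightarrow> 0"
proof (rule tendsto_sandwich[OF _ _ tendsto_const var])
  have "\<forall>\<^sub>F n in sequentially. U (x n) \<le> 1 * V (x n) / x n"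
    using filterlim_iff[THEN iffD1, OF x] law.U_le_V[OF slow zero_less_one] by blast
  moreover have "\<forall>\<^sub>F n in sequentially. x n > 0"
    using x filterlim_at_top_dense by blast
  ultimately show "\<forall>\<^sub>F n in sequentially. real n * G (x n) \<le> real n * V (x n) / (x n)\<^sup>2"
  proof eventually_elim
    case (elim n)
    have "G (x n) \<le> U (x n) / x n"
      by (rule law.G_le_U[OF elim(2)])
    also have "\<dots> \<le> V (x n) / x n / x n"
      using elim by (intro divide_right_mono) auto
    finally show ?case
      by (simp add: power2_eq_square mult_left_mono flip: times_divide_eq_right)
  qed
qed (simp add: upper_tail_nonneg)

text \<open>\<open>R0\<close> precedes the sequences and the precision e: it is fixed by
  \<open>L\<close> through k. Jumps above (1 - \<epsilon>) x contribute the main term with an excess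
  of e / 3, and intermediate and small jumps at most e / 3 each.\<close>

lemma big_jump_upper:
  assumes "L > 0"
  shows "\<exists>R0. \<forall>x \<rho>. filterlim x at_top sequentially \<longrightarrow>
    (\<lambda>n. real n * V (x n) / (x n)\<^sup>2) \<longlonglongrightarrow> 0 \<longrightarrow>
    (\<forall>\<^sub>F n in sequentially. \<rho> n \<ge> R0 \<and> (\<forall>y\<ge>\<rho> n. real n * V y / y \<le> L * x n)) \<longrightarrow>
    (\<forall>e>0. \<forall>\<^sub>F n in sequentially.
      prob {\<omega>\<in>space M. x n \<le> (\<Sum>j<n. Y j \<omega>) \<and> (\<exists>i<n. Y i \<omega> > \<rho> n)} \<le> (1 + e) * (real n * G (x n)))"
proof -
  define k where "k = min 1 (1 / (16 * L))"
  have k: "0 < k" "k \<le> 1" "L * k \<le> 1 / 16"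
    using assms by (auto simp: k_def min_def field_simps)
  obtain p R1 where R1: "R1 > 0" "\<And>z u. R1 \<le> z \<Longrightarrow> z \<le> u \<Longrightarrow> G z \<le> (2 * (u / z)) ^ p * G u"
    using G_power_bound by blast
  obtain R2 where R2: "R2 > 0" "\<And>y. y \<ge> R2 \<Longrightarrow> U y \<le> k * V y / y"
    by (rule eventually_at_top_posE[OF law.U_le_V[OF slow k(1)]]) blast
  obtain T where T: "T > 0" "\<And>t. t \<ge> T \<Longrightarrow> (4 * t) ^ p * exp (- (k / 4 * t)) \<le> 1 / t"
    by (rule eventually_at_top_posE[OF eventually_power_exp_le_inverse[OF k(1), of p]]) blast
  define R where "R = max R1 R2"
  have R: "R > 0" "\<And>y. y \<ge> R \<Longrightarrow> U y \<le> k * V y / y"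
    "\<And>z u. R \<le> z \<Longrightarrow> z \<le> u \<Longrightarrow> G z \<le> (2 * (u / z)) ^ p * G u"
    using R1 R2 by (auto simp: R_def)
  show ?thesis
  proof (rule exI[of _ "2 * R"], intro allI impI)
    fix x \<rho> :: "nat \<Rightarrow> real" and e :: real
    assume x: "filterlim x at_top sequentially"
      and var: "(\<lambda>n. real n * V (x n) / (x n)\<^sup>2) \<longlonglongrightarrow> 0"
      and \<rho>: "\<forall>\<^sub>F n in sequentially. \<rho> n \<ge> 2 * R \<and> (\<forall>y\<ge>\<rho> n. real n * V y / y \<le> L * x n)"
      and e: "e > 0"
    have "e / 3 > 0"
      using e by simp
    obtain c where c: "c > 1" "\<forall>\<^sub>F u in at_top. G u \<le> (1 + e / 3) * G (c * u)"
      using irv[OF \<open>e / 3 > 0\<close>] by blast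
    \<comment> \<open>1 / 2 and 1 / T are required by the dyadic estimate, e / 6 makes its bound 2
      \<epsilon> at most e / 3, and 1 - 1 / c ensures (1 - \<epsilon>) x >= x / c, where
      \<open>irv\<close> compares with G(x).\<close>
    define \<epsilon> where "\<epsilon> = min (min (1 / 2) (1 / T)) (min (e / 6) (1 - 1 / c))"
    have \<epsilon>: "0 < \<epsilon>" "\<epsilon> \<le> 1 / 2" "\<epsilon> \<le> 1 / T" "\<epsilon> \<le> e / 6" "\<epsilon> \<le> 1 - 1 / c"
      using T(1) e c(1) by (simp_all only: \<epsilon>_def min_less_iff_conj min_le_iff_disj) auto
    \<comment> \<open>Compensates the factor in G(\<epsilon> x) <= (2 / \<epsilon>)^p G(x).\<close>
    define \<beta> where "\<beta> = e / 3 / (2 / \<epsilon>) ^ p"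
    have "\<beta> > 0"
      using e \<epsilon> by (simp add: \<beta>_def)
    have wl: "\<forall>\<^sub>F n in sequentially. \<forall>I\<subseteq>{..<n}. prob {\<omega>\<in>space M. \<epsilon> * x n \<le> 1 * (\<Sum>j\<in>I. Y j \<omega>)} \<le> \<beta>"
      by (rule weak_law[OF slow x var \<epsilon>(1) \<open>\<beta> > 0\<close>]) simp
    have "filterlim (\<lambda>n. 1 / c * x n) at_top sequentially"
      using c(1) by (intro filterlim_tendsto_pos_mult_at_top[OF tendsto_const _ x]) auto
    then have "\<forall>\<^sub>F n in sequentially. G (1 / c * x n) \<le> (1 + e / 3) * G (c * (1 / c * x n))"
      using c(2) unfolding filterlim_iff by blast
    then have Gc: "\<forall>\<^sub>F n in sequentially. G (1 / c * x n) \<le> (1 + e / 3) * G (x n)"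
      using c(1) by simp
    have "filterlim (\<lambda>n. \<epsilon> * x n) at_top sequentially"
      using \<epsilon>(1) by (intro filterlim_tendsto_pos_mult_at_top[OF tendsto_const _ x]) auto
    then have xR: "\<forall>\<^sub>F n in sequentially. R \<le> \<epsilon> * x n"
      unfolding filterlim_at_top by blast
    show "\<forall>\<^sub>F n in sequentially.
      prob {\<omega>\<in>space M. x n \<le> (\<Sum>j<n. Y j \<omega>) \<and> (\<exists>i<n. Y i \<omega> > \<rho> n)} \<le> (1 + e) * (real n * G (x n))"
      using wl Gc xR \<rho>
    proof eventually_elim
      case (elim n)
      have "\<epsilon> * x n > 0"
        using elim(3) R(1) by linarith
      then have "x n > 0"
        using \<epsilon>(1) by (simp add: zero_less_mult_iff)
      let ?A = "{\<omega>\<in>space M. \<exists>i<n. Y i \<omega> > (1 - \<epsilon>) * x n}"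
      let ?B = "{\<omega>\<in>space M. x n \<le> (\<Sum>j<n. Y j \<omega>) \<and> (\<exists>i<n. \<epsilon> * x n < Y i \<omega> \<and> Y i \<omega> \<le> (1 - \<epsilon>) * x n)}"
      let ?C = "{\<omega>\<in>space M. x n \<le> (\<Sum>j<n. Y j \<omega>) \<and> (\<exists>i<n. Y i \<omega> > \<rho> n) \<and> (\<forall>j<n. Y j \<omega> \<le> \<epsilon> * x n)}"
      have "prob {\<omega>\<in>space M. x n \<le> (\<Sum>j<n. Y j \<omega>) \<and> (\<exists>i<n. Y i \<omega> > \<rho> n)} \<le> prob (?A \<union> (?B \<union> ?C))"
      proof (rule finite_measure_mono)
        show "{\<omega>\<in>space M. x n \<le> (\<Sum>j<n. Y j \<omega>) \<and> (\<exists>i<n. Y i \<omega> > \<rho> n)} \<subseteq> ?A \<union> (?B \<union> ?C)"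
          unfolding not_le[symmetric] by blast
      qed measurable
      also have "\<dots> \<le> prob ?A + prob (?B \<union> ?C)"
        by (intro measure_Un_le) auto
      also have "prob (?B \<union> ?C) \<le> prob ?B + prob ?C"
        by (intro measure_Un_le) auto
      also have "prob ?A \<le> real n * G ((1 - \<epsilon>) * x n)"
        by (rule prob_exists_Y_greater_le)
      also have "\<dots> \<le> real n * ((1 + e / 3) * G (x n))"
      proof (rule mult_left_mono)
        have "1 / c * x n \<le> (1 - \<epsilon>) * x n"
          using \<epsilon>(5) \<open>x n > 0\<close> by (intro mult_right_mono) auto
        from law.G_antimono[OF this] elim(2)
        show "G ((1 - \<epsilon>) * x n) \<le> (1 + e / 3) * G (x n)"
          by linarith
      qed simp
      also have "prob ?B \<le> real n * (G (\<epsilon> * x n) * \<beta>)"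
        using elim(1) by (intro prob_intermediate_jump_le) simp
      also have "\<dots> \<le> real n * ((2 * (x n / (\<epsilon> * x n))) ^ p * G (x n) * \<beta>)"
        using \<open>\<beta> > 0\<close> \<open>x n > 0\<close> \<epsilon> elim(3) by (intro mult_left_mono mult_right_mono R(3)) auto
      also have "\<dots> = real n * (e / 3 * G (x n))"
        using \<open>x n > 0\<close> \<epsilon>(1) by (simp add: \<beta>_def)
      also have "prob ?C \<le> 2 * \<epsilon> * (real n * G (x n))"
        using elim(4) by (intro prob_small_jumps_le[OF k R T(2,1) \<epsilon>(1-3) \<open>x n > 0\<close>]) auto
      also have "\<dots> \<le> e / 3 * (real n * G (x n))"
        using \<epsilon>(4) by (intro mult_right_mono) (auto simp: upper_tail_nonneg)
      finally show ?case
        by (simp add: algebra_simps)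
    qed
  qed
qed

text \<open>The events that exactly one summand, the \<open>i\<close>-th, exceeds \<open>c * x\<close> are disjoint.\<close>
lemma prob_big_jump_ge:
  assumes \<delta>: "\<forall>I\<subseteq>{..<n}. prob {\<omega>\<in>space M. (c - 1) * x \<le> - (\<Sum>j\<in>I. Y j \<omega>)} \<le> \<delta>"
  shows "real n * (G (c * x) * (1 - \<delta> - real n * G (c * x)))
    \<le> prob {\<omega>\<in>space M. x \<le> (\<Sum>j<n. Y j \<omega>) \<and> (\<exists>i<n. Y i \<omega> > c * x)}"
proof -
  let ?u = "c * x"
  define A where "A i = {\<omega>\<in>space M. Y i \<omega> > ?u \<and> - ((c - 1) * x) \<le> (\<Sum>j\<in>{..<n} - {i}. Y j \<omega>) \<and>
    (\<forall>j\<in>{..<n} - {i}. Y j \<omega> \<le> ?u)}" for i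
  have A_events: "A i \<in> events" for i
    unfolding A_def by measurable
  have A_ge: "G ?u * (1 - \<delta> - real n * G ?u) \<le> prob (A i)" if i: "i < n" for i
  proof -
    let ?I = "{..<n} - {i}"
    let ?B = "{\<omega>\<in>space M. Y i \<omega> \<in> {?u<..} \<and> (\<Sum>j\<in>?I. Y j \<omega>) \<in> {- ((c - 1) * x)..}}"
    let ?C = "{\<omega>\<in>space M. \<exists>j<n. j \<noteq> i \<and> Y i \<omega> > ?u \<and> Y j \<omega> > ?u}"
    have "1 - \<delta> \<le> 1 - prob {\<omega>\<in>space M. (c - 1) * x \<le> - (\<Sum>j\<in>?I. Y j \<omega>)}"
      using \<delta>[rule_format, of ?I] by auto
    also have "\<dots> = prob (space M - {\<omega>\<in>space M. (c - 1) * x \<le> - (\<Sum>j\<in>?I. Y j \<omega>)})"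
      by (rule prob_compl[symmetric]) measurable
    also have "\<dots> \<le> prob {\<omega>\<in>space M. (\<Sum>j\<in>?I. Y j \<omega>) \<in> {- ((c - 1) * x)..}}"
      by (intro finite_measure_mono) auto
    finally have "G ?u * (1 - \<delta>) \<le> G ?u * prob {\<omega>\<in>space M. (\<Sum>j\<in>?I. Y j \<omega>) \<in> {- ((c - 1) * x)..}}"
      by (intro mult_left_mono upper_tail_nonneg)
    also have "\<dots> = prob ?B"
      by (subst prob_Y_and_sum) (auto simp: upper_tail_def)
    also have "\<dots> \<le> prob (A i \<union> ?C)"
      unfolding A_def by (intro finite_measure_mono) (auto simp: not_le)
    also have "\<dots> \<le> prob (A i) + prob ?C"
      using A_events by (intro measure_Un_le) auto
    \<comment> \<open>A second jump costs G(c x)^2 for each of at most n partners; relative to G(c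
      x) this is n G(c x), which tends to 0 in the application.\<close>
    also have "prob ?C \<le> real n * (G ?u * G ?u)"
    proof (rule prob_exists_le)
      fix j
      show "prob {\<omega>\<in>space M. j \<noteq> i \<and> Y i \<omega> > ?u \<and> Y j \<omega> > ?u} \<le> G ?u * G ?u"
        using prob_Y_greater_pair[of i j ?u] upper_tail_nonneg[of D ?u] by (cases "j = i") auto
    qed measurable
    finally show ?thesis
      by (simp add: algebra_simps)
  qed
  have "real n * (G ?u * (1 - \<delta> - real n * G ?u)) = (\<Sum>i<n. G ?u * (1 - \<delta> - real n * G ?u))"
    by simp
  also have "\<dots> \<le> (\<Sum>i<n. prob (A i))"
    using A_ge by (intro sum_mono) auto
  also have "\<dots> = prob (\<Union>i<n. A i)"
  proof (rule finite_measure_finite_Union[symmetric])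
    show "disjoint_family_on A {..<n}"
      unfolding disjoint_family_on_def
    proof (intro ballI impI equals0I)
      fix i j \<omega> assume "i \<in> {..<n}" "j \<in> {..<n}" "i \<noteq> j" "\<omega> \<in> A i \<inter> A j"
      then have "Y i \<omega> > ?u" "Y i \<omega> \<le> ?u"
        by (simp_all add: A_def)
      then show False
        by simp
    qed
  qed (use A_events in auto)
  also have "\<dots> \<le> prob {\<omega>\<in>space M. x \<le> (\<Sum>j<n. Y j \<omega>) \<and> (\<exists>i<n. Y i \<omega> > ?u)}"
  proof (rule finite_measure_mono)
    show "(\<Union>i<n. A i) \<subseteq> {\<omega>\<in>space M. x \<le> (\<Sum>j<n. Y j \<omega>) \<and> (\<exists>i<n. Y i \<omega> > ?u)}"
      by (auto simp: A_def sum_diff_Y algebra_simps)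
  qed measurable
  finally show ?thesis .
qed

text \<open>\<open>c\<close> is tied to e: replacing G(c x) by G(x) costs the factor 1 + e / 2,
  while the weak law and a second jump take e / 4 each.\<close>

lemma big_jump_lower:
  assumes x: "filterlim x at_top sequentially"
    and var: "(\<lambda>n. real n * V (x n) / (x n)\<^sup>2) \<longlonglongrightarrow> 0"
    and e: "0 < e" "e < 1"
  shows "\<exists>c>1. \<forall>\<^sub>F n in sequentially. (1 - e) * (real n * G (x n))
    \<le> prob {\<omega>\<in>space M. x n \<le> (\<Sum>j<n. Y j \<omega>) \<and> (\<exists>i<n. Y i \<omega> > c * x n)}"
proof -
  have "e / 2 > 0" "e / 4 > 0"
    using e by auto
  obtain c where c: "c > 1" "\<forall>\<^sub>F u in at_top. G u \<le> (1 + e / 2) * G (c * u)"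
    using irv[OF \<open>e / 2 > 0\<close>] by blast
  have Gc: "\<forall>\<^sub>F n in sequentially. G (x n) \<le> (1 + e / 2) * G (c * x n)"
    using c(2) x unfolding filterlim_iff by blast
  have wl: "\<forall>\<^sub>F n in sequentially. \<forall>I\<subseteq>{..<n}.
      prob {\<omega>\<in>space M. (c - 1) * x n \<le> -1 * (\<Sum>j\<in>I. Y j \<omega>)} \<le> e / 4"
    using c(1) \<open>e / 4 > 0\<close> by (intro weak_law[OF slow x var]) auto
  have nG: "\<forall>\<^sub>F n in sequentially. real n * G (x n) < e / 4"
    using n_G_tendsto_0[OF x var] \<open>e / 4 > 0\<close> by (rule order_tendstoD)
  have pos: "\<forall>\<^sub>F n in sequentially. x n > 0"
    using x filterlim_at_top_dense by blast
  have "\<forall>\<^sub>F n in sequentially. (1 - e) * (real n * G (x n))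
    \<le> prob {\<omega>\<in>space M. x n \<le> (\<Sum>j<n. Y j \<omega>) \<and> (\<exists>i<n. Y i \<omega> > c * x n)}"
    using Gc wl nG pos
  proof eventually_elim
    case (elim n)
    have "x n \<le> c * x n"
      using elim(4) c(1) by simp
    then have "real n * G (c * x n) \<le> real n * G (x n)"
      by (intro mult_left_mono law.G_antimono) auto
    then have q: "1 - e / 2 \<le> 1 - e / 4 - real n * G (c * x n)"
      using elim(3) by linarith
    have "(1 - e) * (1 + e / 2) \<le> 1 - e / 2"
      using e by (simp add: algebra_simps)
    then have "(1 - e) * (1 + e / 2) * G (c * x n) \<le> (1 - e / 2) * G (c * x n)"
      by (intro mult_right_mono upper_tail_nonneg)
    moreover have "(1 - e) * G (x n) \<le> (1 - e) * ((1 + e / 2) * G (c * x n))"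
      using elim(1) e by (intro mult_left_mono) auto
    ultimately have "(1 - e) * G (x n) \<le> (1 - e / 2) * G (c * x n)"
      by (simp add: mult.assoc)
    also have "\<dots> \<le> (1 - e / 4 - real n * G (c * x n)) * G (c * x n)"
      using q by (intro mult_right_mono upper_tail_nonneg)
    finally have "real n * ((1 - e) * G (x n)) \<le> real n * (G (c * x n) * (1 - e / 4 - real n * G (c * x n)))"
      by (intro mult_left_mono) (auto simp: mult.commute)
    also have "\<dots> \<le> prob {\<omega>\<in>space M. x n \<le> (\<Sum>j<n. Y j \<omega>) \<and> (\<exists>i<n. Y i \<omega> > c * x n)}"
      using elim(2) by (intro prob_big_jump_ge) simp
    finally show ?case
      by (simp add: mult_ac)
  qed
  with c(1) show ?thesis
    by blast
qed

lemma events_sum_and_jump [measurable]: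
  "{\<omega>\<in>space M. t \<le> (\<Sum>j<n. Y j \<omega>) \<and> (\<exists>i<n. Y i \<omega> > u)} \<in> events"
  by measurable

text \<open>A common sandwich for all events in question. \<open>lower\<close> is required for every
  c > 1 because the dilation supplied by \<open>big_jump_lower\<close> varies with the
  precision.\<close>

lemma ratio_tendsto_1:
  assumes x: "filterlim x at_top sequentially"
    and var: "(\<lambda>n. real n * V (x n) / (x n)\<^sup>2) \<longlonglongrightarrow> 0"
    and E: "\<And>n. E n \<in> events"
    and lower: "\<And>c. c > 1 \<Longrightarrow> \<forall>\<^sub>F n in sequentially.
      {\<omega>\<in>space M. x n \<le> (\<Sum>j<n. Y j \<omega>) \<and> (\<exists>i<n. Y i \<omega> > c * x n)} \<subseteq> E n"
    and upper: "\<And>e. e > 0 \<Longrightarrow> \<forall>\<^sub>F n in sequentially. prob (E n) \<le> (1 + e) * (real n * G (x n))"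
  shows "(\<lambda>n. prob (E n) / (real n * G (x n))) \<longlonglongrightarrow> 1"
proof (rule tendstoI)
  fix e :: real assume "e > 0"
  define d where "d = min (e / 2) (1 / 2)"
  have d: "0 < d" "d < 1" "d < e"
    using \<open>e > 0\<close> by (auto simp: d_def min_def)
  obtain c where c: "c > 1" "\<forall>\<^sub>F n in sequentially. (1 - d) * (real n * G (x n))
      \<le> prob {\<omega>\<in>space M. x n \<le> (\<Sum>j<n. Y j \<omega>) \<and> (\<exists>i<n. Y i \<omega> > c * x n)}"
    using big_jump_lower[OF x var d(1,2)] by blast
  show "\<forall>\<^sub>F n in sequentially. dist (prob (E n) / (real n * G (x n))) 1 < e"
    using c(2) lower[OF c(1)] upper[OF d(1)] eventually_gt_at_top[of 0]
  proof eventually_elim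
    case (elim n)
    have pos: "real n * G (x n) > 0"
      using elim(4) G_pos by simp
    have "(1 - d) * (real n * G (x n)) \<le> prob (E n)"
      using elim(1) finite_measure_mono[OF elim(2) E] by linarith
    then have "1 - d \<le> prob (E n) / (real n * G (x n))"
      by (simp add: pos_le_divide_eq[OF pos])
    moreover have "prob (E n) / (real n * G (x n)) \<le> 1 + d"
      using elim(3) by (simp add: pos_divide_le_eq[OF pos])
    ultimately show ?case
      using d(3) by (simp add: dist_real_def abs_less_iff)
  qed
qed

text \<open>A fixed shift is eventually dominated by any dilation, u / c <= u - m <= c u, whatever
  the sign of m. This reconciles G(x), the tail at x + \<mu>, with the tail at x.\<close>

lemma G_shift_tendsto: "((\<lambda>u. G (u - m) / G u) \<longlongrightarrow> 1) at_top"
proof (rule tendstoI)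
  fix e :: real assume "e > 0"
  define d where "d = e / 2"
  have d: "0 < d" "d < e"
    using \<open>e > 0\<close> by (auto simp: d_def)
  obtain c where c: "c > 1" "\<forall>\<^sub>F u in at_top. G u \<le> (1 + d) * G (c * u)"
    using irv[OF d(1)] by blast
  have "filterlim (\<lambda>u. 1 / c * u) at_top at_top"
    using c(1) by (intro filterlim_tendsto_pos_mult_at_top[OF tendsto_const _ filterlim_ident]) auto
  then have "\<forall>\<^sub>F u in at_top. G (1 / c * u) \<le> (1 + d) * G (c * (1 / c * u))"
    using c(2) unfolding filterlim_iff by blast
  moreover have "\<forall>\<^sub>F u in at_top. 1 / c * u \<le> u - m"
    using c(1) by real_asymp
  moreover have "\<forall>\<^sub>F u in at_top. u - m \<le> c * u"
    using c(1) by real_asymp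
  ultimately show "\<forall>\<^sub>F u in at_top. dist (G (u - m) / G u) 1 < e"
    using c(2)
  proof eventually_elim
    case (elim u)
    have "G (u - m) \<le> (1 + d) * G u"
      using elim(1) law.G_antimono[OF elim(2)] c(1) by simp
    then have "G (u - m) / G u \<le> 1 + d"
      by (simp add: pos_divide_le_eq[OF G_pos])
    moreover have "(1 + d) * G (c * u) \<le> (1 + d) * G (u - m)"
      using law.G_antimono[OF elim(3)] d by (intro mult_left_mono) auto
    then have "G u \<le> (1 + d) * G (u - m)"
      using elim(4) by linarith
    then have "1 \<le> (1 + d) * (G (u - m) / G u)"
      using G_pos[of u] by (simp add: field_simps)
    then have "1 - d \<le> G (u - m) / G u"
    proof -
      have "(1 - d) * 1 \<le> 1 / (1 + d)"
        using d by (simp add: field_simps)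
      also have "\<dots> \<le> G (u - m) / G u"
        using \<open>1 \<le> (1 + d) * (G (u - m) / G u)\<close> d by (simp add: divide_le_eq mult.commute)
      finally show ?thesis by simp
    qed
    ultimately show ?case
      using d(2) by (simp add: dist_real_def abs_less_iff)
  qed
qed

section \<open>The regime in which \<open>x n\<close> is of order at least n\<close>

text \<open>Chernoff with parameter 1 / R: the loss is at most 4 n V(R) / R^2, and V(R) / R <
  \<kappa> / 8 with \<kappa> n <= x bounds it by x / (2 R), half of the gain. The resulting
  exponential decay in x beats the at most polynomial decay of G.\<close>

lemma truncated_sum_negligible:
  assumes "\<kappa> > 0"
  shows "\<forall>\<^sub>F R in at_top. \<forall>x. filterlim x at_top sequentially \<longrightarrow>
    (\<forall>\<^sub>F n in sequentially. \<kappa> * real n \<le> x n) \<longrightarrow>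
    (\<lambda>n. prob {\<omega>\<in>space M. x n \<le> (\<Sum>j<n. Y j \<omega>) \<and> (\<forall>j<n. Y j \<omega> \<le> R)} / (real n * G (x n))) \<longlonglongrightarrow> 0"
proof -
  have "\<kappa> / 8 > 0"
    using assms by simp
  obtain p R1 where R1: "R1 > 0" "\<And>z u. R1 \<le> z \<Longrightarrow> z \<le> u \<Longrightarrow> G z \<le> (2 * (u / z)) ^ p * G u"
    using G_power_bound by blast
  show ?thesis
    using law.U_le_V[OF slow zero_less_one] order_tendstoD(2)[OF law.V_over_tendsto_0 \<open>\<kappa> / 8 > 0\<close>]
      eventually_gt_at_top[of 0]
  proof (eventually_elim, intro allI impI)
    fix R :: real and x :: "nat \<Rightarrow> real"
    assume U: "U R \<le> 1 * V R / R" and V: "V R / R < \<kappa> / 8" and "R > 0"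
      and x: "filterlim x at_top sequentially"
      and \<kappa>: "\<forall>\<^sub>F n in sequentially. \<kappa> * real n \<le> x n"
    \<comment> \<open>exp(- u / (2 R)) divided by the lower bound G(R1) / (2 u / R1)^p for G(u); the
      factor n >= 1 in the denominator is dropped.\<close>
    define b where "b u = exp (- (u / (2 * R))) * ((2 * (u / R1)) ^ p / G R1)" for u
    have "filterlim (\<lambda>u. 1 / (2 * R) * u) at_top at_top"
      using \<open>R > 0\<close> by (intro filterlim_tendsto_pos_mult_at_top[OF tendsto_const _ filterlim_ident]) auto
    then have "((\<lambda>u. (1 / (2 * R) * u) ^ p / exp (1 / (2 * R) * u)) \<longlongrightarrow> 0) at_top"
      by (rule filterlim_compose[OF tendsto_power_div_exp_0])
    then have "((\<lambda>u. (4 * R / R1) ^ p / G R1 * ((1 / (2 * R) * u) ^ p / exp (1 / (2 * R) * u))) \<longlongrightarrow> 0) at_top"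
      by (rule tendsto_mult_right_zero)
    moreover have "(4 * R / R1) ^ p / G R1 * ((1 / (2 * R) * u) ^ p / exp (1 / (2 * R) * u)) = b u" for u
    proof -
      have "(4 * R / R1) ^ p * (1 / (2 * R) * u) ^ p = (2 * (u / R1)) ^ p"
        using \<open>R > 0\<close> by (simp flip: power_mult_distrib)
      then have "(4 * R / R1) ^ p / G R1 * ((1 / (2 * R) * u) ^ p / exp (1 / (2 * R) * u))
          = (2 * (u / R1)) ^ p / G R1 / exp (1 / (2 * R) * u)"
        by (simp only: times_divide_times_eq divide_divide_eq_left)
      moreover have "exp (- (u / (2 * R))) = 1 / exp (1 / (2 * R) * u)"
        by (simp add: exp_minus inverse_eq_divide)
      moreover have "G R1 \<noteq> 0"
        using G_pos[of R1] by linarith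
      ultimately show ?thesis
        by (simp add: b_def mult.commute)
    qed
    ultimately have "(b \<longlongrightarrow> 0) at_top"
      by simp
    then have bx: "(\<lambda>n. b (x n)) \<longlonglongrightarrow> 0"
      using x by (rule filterlim_compose)
    have xR: "\<forall>\<^sub>F n in sequentially. R1 \<le> x n"
      using x unfolding filterlim_at_top by blast
    show "(\<lambda>n. prob {\<omega>\<in>space M. x n \<le> (\<Sum>j<n. Y j \<omega>) \<and> (\<forall>j<n. Y j \<omega> \<le> R)} / (real n * G (x n))) \<longlonglongrightarrow> 0"
    proof (rule tendsto_sandwich[OF _ _ tendsto_const bx])
      show "\<forall>\<^sub>F n in sequentially. prob {\<omega>\<in>space M. x n \<le> (\<Sum>j<n. Y j \<omega>) \<and> (\<forall>j<n. Y j \<omega> \<le> R)}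
          / (real n * G (x n)) \<le> b (x n)"
        using xR \<kappa> eventually_gt_at_top[of 0]
      proof eventually_elim
        case (elim n)
        have "x n > 0"
          using elim(1) R1(1) by linarith
        have "prob {\<omega>\<in>space M. x n \<le> (\<Sum>j<n. Y j \<omega>) \<and> (\<forall>j<n. Y j \<omega> \<le> R)}
          = prob {\<omega>\<in>space M. Y n \<omega> \<in> UNIV \<and> (\<forall>j\<in>{..<n}. 1 * Y j \<omega> \<le> R) \<and> x n \<le> 1 * (\<Sum>j\<in>{..<n}. Y j \<omega>)}"
          by (rule arg_cong[where f = prob]) auto
        also have "\<dots> \<le> measure D UNIV * exp (- (1 * x n / R) + real n * (1 * U R / R + 1\<^sup>2 * exp 1 * V R / R\<^sup>2))"
          using \<open>R > 0\<close> by (intro truncated_sum_tail) auto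
        also have "\<dots> = exp (- (x n / R) + real n * (U R / R + exp 1 * V R / R\<^sup>2))"
          using law.prob_space by simp
        also have "\<dots> \<le> exp (- (x n / (2 * R)))"
        proof -
          have "U R / R \<le> V R / R / R"
            using U \<open>R > 0\<close> by (intro divide_right_mono) auto
          moreover have "exp 1 * V R / R\<^sup>2 \<le> 3 * V R / R\<^sup>2"
            using exp_le trunc_second_moment_nonneg[of D] by (intro divide_right_mono mult_right_mono) auto
          ultimately have "U R / R + exp 1 * V R / R\<^sup>2 \<le> 4 / R * (V R / R)"
            by (simp add: power2_eq_square)
          also have "\<dots> \<le> 4 / R * (\<kappa> / 8)"
            using V \<open>R > 0\<close> by (intro mult_left_mono) auto
          finally have "real n * (U R / R + exp 1 * V R / R\<^sup>2) \<le> real n * (4 / R * (\<kappa> / 8))"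
            by (intro mult_left_mono) auto
          also have "\<dots> = (\<kappa> * real n) / (2 * R)"
            by simp
          also have "\<dots> \<le> x n / (2 * R)"
            using elim(2) \<open>R > 0\<close> by (intro divide_right_mono) auto
          finally show ?thesis
            using \<open>R > 0\<close> by simp
        qed
        finally have P: "prob {\<omega>\<in>space M. x n \<le> (\<Sum>j<n. Y j \<omega>) \<and> (\<forall>j<n. Y j \<omega> \<le> R)} \<le> exp (- (x n / (2 * R)))" .
        have "G R1 / (2 * (x n / R1)) ^ p \<le> G (x n)"
          using R1(2)[OF order.refl elim(1)] \<open>x n > 0\<close> R1(1) by (simp add: divide_le_eq mult.commute)
        also have "\<dots> \<le> real n * G (x n)"
          using elim(3) G_pos[of "x n"] by simp
        finally have "exp (- (x n / (2 * R))) / (real n * G (x n)) \<le> exp (- (x n / (2 * R))) / (G R1 / (2 * (x n / R1)) ^ p)"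
          using \<open>x n > 0\<close> R1(1) G_pos elim(3) by (intro divide_left_mono mult_pos_pos divide_pos_pos) auto
        also have "\<dots> = b (x n)"
          by (simp add: b_def)
        finally show ?case
          using divide_right_mono[OF P, of "real n * G (x n)"] G_pos[of "x n"] by simp
      qed
  qed (simp add: upper_tail_nonneg)
  qed
qed

text \<open>The threshold is a constant R: once V(y) / y < \<kappa> for y >= R, \<kappa> n <= x
  gives n V(y) / y <= x, so the upper bound applies with L = 1. What remains, all summands at most
  R, is negligible.\<close>

lemma linear_threshold:
  assumes x: "filterlim x at_top sequentially" and "\<kappa> > 0"
    and \<kappa>: "\<forall>\<^sub>F n in sequentially. \<kappa> * real n \<le> x n"
    and E: "\<And>n. E n \<in> events"
    and lower: "\<And>c. c > 1 \<Longrightarrow> \<forall>\<^sub>F n in sequentially.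
      {\<omega>\<in>space M. x n \<le> (\<Sum>j<n. Y j \<omega>) \<and> (\<exists>i<n. Y i \<omega> > c * x n)} \<subseteq> E n"
    and upper: "\<forall>\<^sub>F n in sequentially. E n \<subseteq> {\<omega>\<in>space M. x n \<le> (\<Sum>j<n. Y j \<omega>)}"
  shows "(\<lambda>n. prob (E n) / (real n * G (x n))) \<longlonglongrightarrow> 1"
proof -
  have pos: "\<forall>\<^sub>F n in sequentially. x n > 0"
    using x filterlim_at_top_dense by blast
  have var: "(\<lambda>n. real n * V (x n) / (x n)\<^sup>2) \<longlonglongrightarrow> 0"
  proof (rule tendsto_sandwich[OF _ _ tendsto_const])
    show "\<forall>\<^sub>F n in sequentially. real n * V (x n) / (x n)\<^sup>2 \<le> 1 / \<kappa> * (V (x n) / x n)"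
      using \<kappa> pos
    proof eventually_elim
      case (elim n)
      have "real n / x n \<le> 1 / \<kappa>"
        using elim \<open>\<kappa> > 0\<close> by (simp add: field_simps)
      then have "real n / x n * (V (x n) / x n) \<le> 1 / \<kappa> * (V (x n) / x n)"
        using elim trunc_second_moment_nonneg by (intro mult_right_mono) auto
      then show ?case
        by (simp add: power2_eq_square)
    qed
    show "(\<lambda>n. 1 / \<kappa> * (V (x n) / x n)) \<longlonglongrightarrow> 0"
      by (rule tendsto_mult_right_zero[OF filterlim_compose[OF law.V_over_tendsto_0 x]])
  qed (simp add: trunc_second_moment_nonneg)
  obtain R0 where R0: "\<And>x \<rho> e. filterlim x at_top sequentially \<Longrightarrow>
      (\<lambda>n. real n * V (x n) / (x n)\<^sup>2) \<longlonglongrightarrow> 0 \<Longrightarrow>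
      \<forall>\<^sub>F n in sequentially. \<rho> n \<ge> R0 \<and> (\<forall>y\<ge>\<rho> n. real n * V y / y \<le> 1 * x n) \<Longrightarrow> e > 0 \<Longrightarrow>
      \<forall>\<^sub>F n in sequentially. prob {\<omega>\<in>space M. x n \<le> (\<Sum>j<n. Y j \<omega>) \<and> (\<exists>i<n. Y i \<omega> > \<rho> n)}
        \<le> (1 + e) * (real n * G (x n))"
    using big_jump_upper[OF zero_less_one] by blast
  have "\<forall>\<^sub>F y in at_top. V y / y < \<kappa>"
    using law.V_over_tendsto_0 \<open>\<kappa> > 0\<close> by (rule order_tendstoD)
  then obtain R2 where R2: "\<And>y. y \<ge> R2 \<Longrightarrow> V y / y < \<kappa>"
    by (rule eventually_at_top_posE) blast
  obtain R3 where R3: "\<And>R. R \<ge> R3 \<Longrightarrow>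
      (\<lambda>n. prob {\<omega>\<in>space M. x n \<le> (\<Sum>j<n. Y j \<omega>) \<and> (\<forall>j<n. Y j \<omega> \<le> R)} / (real n * G (x n))) \<longlonglongrightarrow> 0"
    by (rule eventually_at_top_posE[OF truncated_sum_negligible[OF \<open>\<kappa> > 0\<close>]]) (use x \<kappa> in blast)
  define R where "R = max R0 (max R2 R3)"
  have R: "R \<ge> R0" "R \<ge> R2" "R \<ge> R3"
    by (auto simp: R_def)
  have cond: "\<forall>\<^sub>F n in sequentially. R \<ge> R0 \<and> (\<forall>y\<ge>R. real n * V y / y \<le> 1 * x n)"
    using \<kappa>
  proof eventually_elim
    case (elim n)
    have "real n * V y / y \<le> x n" if "y \<ge> R" for y
    proof -
      have "real n * (V y / y) \<le> real n * \<kappa>"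
        using R2[of y] that R by (intro mult_left_mono) auto
      with elim show ?thesis
        by (simp add: mult.commute)
    qed
    with R show ?case
      by simp
  qed
  show ?thesis
  proof (rule ratio_tendsto_1[OF x var E lower])
    fix e :: real assume "e > 0"
    then have e2: "e / 2 > 0"
      by simp
    show "\<forall>\<^sub>F n in sequentially. prob (E n) \<le> (1 + e) * (real n * G (x n))"
      using upper R0[OF x var cond e2] order_tendstoD(2)[OF R3[OF R(3)] e2] eventually_gt_at_top[of 0]
    proof eventually_elim
      case (elim n)
      let ?A = "{\<omega>\<in>space M. x n \<le> (\<Sum>j<n. Y j \<omega>) \<and> (\<exists>i<n. Y i \<omega> > R)}"
      let ?B = "{\<omega>\<in>space M. x n \<le> (\<Sum>j<n. Y j \<omega>) \<and> (\<forall>j<n. Y j \<omega> \<le> R)}"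
      have "real n * G (x n) > 0"
        using elim(4) G_pos by simp
      from elim(3) have "prob ?B \<le> e / 2 * (real n * G (x n))"
        unfolding pos_divide_less_eq[OF \<open>real n * G (x n) > 0\<close>] by (rule less_imp_le)
      moreover have "E n \<subseteq> ?A \<union> ?B"
        using elim(1) unfolding not_le[symmetric] by blast
      then have "prob (E n) \<le> prob (?A \<union> ?B)"
        by (intro finite_measure_mono) auto
      moreover have "prob (?A \<union> ?B) \<le> prob ?A + prob ?B"
        by (intro measure_Un_le) auto
      ultimately have "prob (E n) \<le> (1 + e / 2) * (real n * G (x n)) + e / 2 * (real n * G (x n))"
        using elim(2) by linarith
      then show ?case
        by (simp add: algebra_simps)
    qed
  qed
qed

section \<open>The regime in which \<open>x n\<close> is of smaller order than n\<close>

text \<open>Comparing V(z) / z at a and x gives n V(x) / x^2 <= 2 (n V(a) / a^2) (a / x), which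
  tends to 0. The bound \<rho> <= x ensures that a jump above c x also passes the threshold.\<close>

lemma sublinear_threshold_facts:
  assumes a: "filterlim a at_top sequentially" "(\<lambda>n. real n * V (a n) / (a n)\<^sup>2) \<longlonglongrightarrow> 1"
    and xa: "filterlim (\<lambda>n. x n / a n) at_top sequentially"
    and \<rho>: "filterlim \<rho> at_top sequentially" "\<forall>\<^sub>F n in sequentially. real n * V (\<rho> n) / \<rho> n \<le> 2 * x n"
      "\<forall>\<^sub>F n in sequentially. x n \<le> 2 * (real n * V (\<rho> n) / \<rho> n)"
  shows "filterlim x at_top sequentially"
    and "(\<lambda>n. real n * V (x n) / (x n)\<^sup>2) \<longlonglongrightarrow> 0"
    and "\<forall>\<^sub>F n in sequentially. \<rho> n \<le> x n"
proof -
  have a_pos: "\<forall>\<^sub>F n in sequentially. a n > 0"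
    using a(1) filterlim_at_top_dense by blast
  have "\<forall>\<^sub>F n in sequentially. 1 \<le> x n / a n"
    using xa unfolding filterlim_at_top by blast
  with a_pos have ax: "\<forall>\<^sub>F n in sequentially. a n \<le> x n"
    by eventually_elim (simp add: field_simps)
  show x: "filterlim x at_top sequentially"
    by (rule filterlim_at_top_mono[OF a(1) ax])
  have qd: "\<forall>\<^sub>F y in at_top. \<forall>z\<ge>y. V z / z \<le> 2 * (V y / y)"
    by (rule law.V_over_quasi_decreasing[OF slow])
  have qd_a: "\<forall>\<^sub>F n in sequentially. \<forall>z\<ge>a n. V z / z \<le> 2 * (V (a n) / a n)"
    using qd a(1) unfolding filterlim_iff by blast
  have qd_x: "\<forall>\<^sub>F n in sequentially. \<forall>z\<ge>x n. V z / z \<le> 2 * (V (x n) / x n)"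
    using qd x unfolding filterlim_iff by blast
  show var: "(\<lambda>n. real n * V (x n) / (x n)\<^sup>2) \<longlonglongrightarrow> 0"
  proof (rule tendsto_sandwich[OF _ _ tendsto_const])
    have "(\<lambda>n. inverse (x n / a n)) \<longlonglongrightarrow> 0"
      by (rule tendsto_inverse_0_at_top[OF xa])
    from tendsto_mult[OF tendsto_mult[OF tendsto_const[of 2] a(2)] this]
    show "(\<lambda>n. 2 * (real n * V (a n) / (a n)\<^sup>2) * inverse (x n / a n)) \<longlonglongrightarrow> 0"
      by simp
    show "\<forall>\<^sub>F n in sequentially. real n * V (x n) / (x n)\<^sup>2
        \<le> 2 * (real n * V (a n) / (a n)\<^sup>2) * inverse (x n / a n)"
      using a_pos ax qd_a
    proof eventually_elim
      case (elim n)
      have "real n / x n * (V (x n) / x n) \<le> real n / x n * (2 * (V (a n) / a n))"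
        using elim by (intro mult_left_mono) auto
      also have "\<dots> = 2 * (real n * V (a n) / (a n)\<^sup>2) * inverse (x n / a n)"
        using elim by (simp add: power2_eq_square mult_ac)
      finally show ?case
        by (simp add: power2_eq_square)
    qed
  qed (simp add: trunc_second_moment_nonneg)
  \<comment> \<open>If \<rho> > x, quasi-monotonicity and the lower bound on n V(\<rho>) / \<rho>,
    each with a factor 2, would force x <= 4 n V(x) / x.\<close>
  have "\<forall>\<^sub>F n in sequentially. real n * V (x n) / (x n)\<^sup>2 < 1 / 4"
    using var by (rule order_tendstoD) simp
  moreover have x_pos: "\<forall>\<^sub>F n in sequentially. x n > 0"
    using x filterlim_at_top_dense by blast
  ultimately show "\<forall>\<^sub>F n in sequentially. \<rho> n \<le> x n"
    using qd_x \<rho>(3)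
  proof eventually_elim
    case (elim n)
    show ?case
    proof (rule ccontr)
      assume "\<not> \<rho> n \<le> x n"
      then have "V (\<rho> n) / \<rho> n \<le> 2 * (V (x n) / x n)"
        using elim(3) by simp
      then have "real n * (V (\<rho> n) / \<rho> n) \<le> real n * (2 * (V (x n) / x n))"
        by (intro mult_left_mono) auto
      then have "x n \<le> 4 * (real n * V (x n) / x n)"
        using elim(4) by simp
      moreover have "4 * (real n * V (x n) / x n) < x n"
        using elim(1,2) by (simp add: field_simps power2_eq_square)
      ultimately show False
        by linarith
    qed
  qed
qed

text \<open>\<open>upper\<close> is stated with \<rho> / 2 so that it tolerates a bounded shift of
  the threshold, such as the one caused by the mean.\<close>

lemma sublinear_threshold:
  assumes x: "filterlim x at_top sequentially"
    and var: "(\<lambda>n. real n * V (x n) / (x n)\<^sup>2) \<longlonglongrightarrow> 0"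
    and \<rho>: "filterlim \<rho> at_top sequentially" "\<forall>\<^sub>F n in sequentially. real n * V (\<rho> n) / \<rho> n \<le> 2 * x n"
    and E: "\<And>n. E n \<in> events"
    and lower: "\<And>c. c > 1 \<Longrightarrow> \<forall>\<^sub>F n in sequentially.
      {\<omega>\<in>space M. x n \<le> (\<Sum>j<n. Y j \<omega>) \<and> (\<exists>i<n. Y i \<omega> > c * x n)} \<subseteq> E n"
    and upper: "\<forall>\<^sub>F n in sequentially.
      E n \<subseteq> {\<omega>\<in>space M. x n \<le> (\<Sum>j<n. Y j \<omega>) \<and> (\<exists>i<n. Y i \<omega> > \<rho> n / 2)}"
  shows "(\<lambda>n. prob (E n) / (real n * G (x n))) \<longlonglongrightarrow> 1"
proof -
  \<comment> \<open>The constant 8 is 2 from the hypothesis on \<rho>, 2 from halving \<rho>, and 2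
    from quasi-monotonicity of V(y) / y.\<close>
  obtain R0 where R0: "\<And>x \<rho> e. filterlim x at_top sequentially \<Longrightarrow>
      (\<lambda>n. real n * V (x n) / (x n)\<^sup>2) \<longlonglongrightarrow> 0 \<Longrightarrow>
      \<forall>\<^sub>F n in sequentially. \<rho> n \<ge> R0 \<and> (\<forall>y\<ge>\<rho> n. real n * V y / y \<le> 8 * x n) \<Longrightarrow> e > 0 \<Longrightarrow>
      \<forall>\<^sub>F n in sequentially. prob {\<omega>\<in>space M. x n \<le> (\<Sum>j<n. Y j \<omega>) \<and> (\<exists>i<n. Y i \<omega> > \<rho> n)}
        \<le> (1 + e) * (real n * G (x n))"
    using big_jump_upper[of 8] by auto
  have \<rho>2: "filterlim (\<lambda>n. 1 / 2 * \<rho> n) at_top sequentially"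
    by (intro filterlim_tendsto_pos_mult_at_top[OF tendsto_const _ \<rho>(1)]) auto
  have ge: "\<forall>\<^sub>F n in sequentially. max R0 1 \<le> 1 / 2 * \<rho> n"
    using \<rho>2 unfolding filterlim_at_top by blast
  have "\<forall>\<^sub>F n in sequentially. \<forall>z\<ge>1 / 2 * \<rho> n. V z / z \<le> 2 * (V (1 / 2 * \<rho> n) / (1 / 2 * \<rho> n))"
    using law.V_over_quasi_decreasing[OF slow] \<rho>2 unfolding filterlim_iff by blast
  then have cond: "\<forall>\<^sub>F n in sequentially. \<rho> n / 2 \<ge> R0 \<and> (\<forall>y\<ge>\<rho> n / 2. real n * V y / y \<le> 8 * x n)"
    using ge \<rho>(2)
  proof eventually_elim
    case (elim n)
    have "real n * V y / y \<le> 8 * x n" if "y \<ge> \<rho> n / 2" for y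
    proof -
      have "V y / y \<le> 2 * (V (1 / 2 * \<rho> n) / (1 / 2 * \<rho> n))"
        using elim(1) that by simp
      also have "\<dots> \<le> 2 * (V (\<rho> n) / (1 / 2 * \<rho> n))"
        using elim(2) by (intro mult_left_mono divide_right_mono law.V_mono) auto
      finally have "real n * (V y / y) \<le> real n * (2 * (V (\<rho> n) / (1 / 2 * \<rho> n)))"
        by (rule mult_left_mono) simp
      also have "\<dots> = 4 * (real n * V (\<rho> n) / \<rho> n)"
        by simp
      also have "\<dots> \<le> 8 * x n"
        using elim(3) by linarith
      finally show ?thesis
        by simp
    qed
    with elim(2) show ?case
      by simp
  qed
  show ?thesis
  proof (rule ratio_tendsto_1[OF x var E lower])
    fix e :: real assume "e > 0"
    from upper R0[OF x var cond this]
    show "\<forall>\<^sub>F n in sequentially. prob (E n) \<le> (1 + e) * (real n * G (x n))"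
    proof eventually_elim
      case (elim n)
      then show ?case
        using finite_measure_mono[OF elim(1) events_sum_and_jump] by linarith
    qed
  qed
qed

text \<open>Below, \<open>m\<close> is the mean of the uncentred summands.\<close>

lemma sublinear_threshold_max:
  assumes a: "filterlim a at_top sequentially" "(\<lambda>n. real n * V (a n) / (a n)\<^sup>2) \<longlonglongrightarrow> 1"
    and xa: "filterlim (\<lambda>n. x n / a n) at_top sequentially"
    and \<rho>: "filterlim \<rho> at_top sequentially" "\<forall>\<^sub>F n in sequentially. real n * V (\<rho> n) / \<rho> n \<le> 2 * x n"
      "\<forall>\<^sub>F n in sequentially. x n \<le> 2 * (real n * V (\<rho> n) / \<rho> n)"
  shows "(\<lambda>n. prob {\<omega>\<in>space M. x n \<le> (\<Sum>j<n. Y j \<omega>) \<and> (\<exists>i<n. Y i \<omega> > \<rho> n - m)}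
      / (real n * G (x n))) \<longlonglongrightarrow> 1"
    and "(\<lambda>n. prob {\<omega>\<in>space M. x n \<le> (\<Sum>j<n. Y j \<omega>) \<and> (\<exists>i<n. Y i \<omega> \<ge> x n - m)}
      / (real n * G (x n))) \<longlonglongrightarrow> 1"
proof -
  note x = sublinear_threshold_facts(1)[OF a xa \<rho>] and var = sublinear_threshold_facts(2)[OF a xa \<rho>]
    and \<rho>_le = sublinear_threshold_facts(3)[OF a xa \<rho>]
  \<comment> \<open>Yields \<rho> / 2 <= \<rho> - m; the extra 1 makes \<rho> / 2 < x - m strict, as
    the passage from a weak to a strict inequality for the jump requires.\<close>
  have big_\<rho>: "\<forall>\<^sub>F n in sequentially. 2 * \<bar>m\<bar> + 1 \<le> \<rho> n"
    using \<rho>(1) unfolding filterlim_at_top by blast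
  have big_x: "\<forall>\<^sub>F n in sequentially. \<bar>m\<bar> \<le> (c - 1) * x n" if "c > 1" for c
    using filterlim_tendsto_pos_mult_at_top[OF tendsto_const _ x, of "c - 1"] that
    unfolding filterlim_at_top by simp
  show "(\<lambda>n. prob {\<omega>\<in>space M. x n \<le> (\<Sum>j<n. Y j \<omega>) \<and> (\<exists>i<n. Y i \<omega> > \<rho> n - m)}
      / (real n * G (x n))) \<longlonglongrightarrow> 1"
  proof (rule sublinear_threshold[OF x var \<rho>(1,2)])
    show "\<forall>\<^sub>F n in sequentially. {\<omega>\<in>space M. x n \<le> (\<Sum>j<n. Y j \<omega>) \<and> (\<exists>i<n. Y i \<omega> > c * x n)}
        \<subseteq> {\<omega>\<in>space M. x n \<le> (\<Sum>j<n. Y j \<omega>) \<and> (\<exists>i<n. Y i \<omega> > \<rho> n - m)}" if "c > 1" for c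
      using big_x[OF that] \<rho>_le
    proof eventually_elim
      case (elim n)
      have "\<rho> n - m \<le> c * x n"
        using elim by (simp add: algebra_simps)
      then show ?case
        by (blast intro: le_less_trans)
    qed
    show "\<forall>\<^sub>F n in sequentially. {\<omega>\<in>space M. x n \<le> (\<Sum>j<n. Y j \<omega>) \<and> (\<exists>i<n. Y i \<omega> > \<rho> n - m)}
        \<subseteq> {\<omega>\<in>space M. x n \<le> (\<Sum>j<n. Y j \<omega>) \<and> (\<exists>i<n. Y i \<omega> > \<rho> n / 2)}"
      using big_\<rho>
    proof eventually_elim
      case (elim n)
      have "\<rho> n / 2 \<le> \<rho> n - m"
        using elim by linarith
      then show ?case
        by (blast intro: le_less_trans)
    qed
  qed measurable
  show "(\<lambda>n. prob {\<omega>\<in>space M. x n \<le> (\<Sum>j<n. Y j \<omega>) \<and> (\<exists>i<n. Y i \<omega> \<ge> x n - m)}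
      / (real n * G (x n))) \<longlonglongrightarrow> 1"
  proof (rule sublinear_threshold[OF x var \<rho>(1,2)])
    show "\<forall>\<^sub>F n in sequentially. {\<omega>\<in>space M. x n \<le> (\<Sum>j<n. Y j \<omega>) \<and> (\<exists>i<n. Y i \<omega> > c * x n)}
        \<subseteq> {\<omega>\<in>space M. x n \<le> (\<Sum>j<n. Y j \<omega>) \<and> (\<exists>i<n. Y i \<omega> \<ge> x n - m)}" if "c > 1" for c
      using big_x[OF that]
    proof eventually_elim
      case (elim n)
      have "x n - m \<le> c * x n"
        using elim by (simp add: algebra_simps)
      then show ?case
        by (blast intro: less_imp_le order.trans)
    qed
    show "\<forall>\<^sub>F n in sequentially. {\<omega>\<in>space M. x n \<le> (\<Sum>j<n. Y j \<omega>) \<and> (\<exists>i<n. Y i \<omega> \<ge> x n - m)}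
        \<subseteq> {\<omega>\<in>space M. x n \<le> (\<Sum>j<n. Y j \<omega>) \<and> (\<exists>i<n. Y i \<omega> > \<rho> n / 2)}"
      using big_\<rho> \<rho>_le
    proof eventually_elim
      case (elim n)
      have "\<rho> n / 2 < x n - m"
        using elim by linarith
      then show ?case
        by (blast intro: less_le_trans)
    qed
  qed measurable
qed

lemma linear_threshold_max:
  assumes "\<kappa> > 0" and \<kappa>: "\<forall>\<^sub>F n in sequentially. \<kappa> * real n \<le> x n"
  shows "filterlim x at_top sequentially"
    and "(\<lambda>n. prob {\<omega>\<in>space M. x n \<le> (\<Sum>j<n. Y j \<omega>)} / (real n * G (x n))) \<longlonglongrightarrow> 1"
    and "(\<lambda>n. prob {\<omega>\<in>space M. x n \<le> (\<Sum>j<n. Y j \<omega>) \<and> (\<exists>i<n. Y i \<omega> \<ge> x n - m)}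
      / (real n * G (x n))) \<longlonglongrightarrow> 1"
proof -
  have "filterlim (\<lambda>n. \<kappa> * real n) at_top sequentially"
    using \<open>\<kappa> > 0\<close> by (intro filterlim_tendsto_pos_mult_at_top[OF tendsto_const _ filterlim_real_sequentially])
  then show x: "filterlim x at_top sequentially"
    using \<kappa> by (rule filterlim_at_top_mono)
  show "(\<lambda>n. prob {\<omega>\<in>space M. x n \<le> (\<Sum>j<n. Y j \<omega>)} / (real n * G (x n))) \<longlonglongrightarrow> 1"
    by (rule linear_threshold[OF x assms]) (auto intro!: always_eventually)
  show "(\<lambda>n. prob {\<omega>\<in>space M. x n \<le> (\<Sum>j<n. Y j \<omega>) \<and> (\<exists>i<n. Y i \<omega> \<ge> x n - m)}
      / (real n * G (x n))) \<longlonglongrightarrow> 1"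
  proof (rule linear_threshold[OF x assms])
    show "\<forall>\<^sub>F n in sequentially. {\<omega>\<in>space M. x n \<le> (\<Sum>j<n. Y j \<omega>) \<and> (\<exists>i<n. Y i \<omega> > c * x n)}
        \<subseteq> {\<omega>\<in>space M. x n \<le> (\<Sum>j<n. Y j \<omega>) \<and> (\<exists>i<n. Y i \<omega> \<ge> x n - m)}" if "c > 1" for c
    proof -
      have "\<forall>\<^sub>F n in sequentially. \<bar>m\<bar> \<le> (c - 1) * x n"
        using filterlim_tendsto_pos_mult_at_top[OF tendsto_const _ x, of "c - 1"] that
        unfolding filterlim_at_top by simp
      then show ?thesis
      proof eventually_elim
        case (elim n)
        have "x n - m \<le> c * x n"
          using elim by (simp add: algebra_simps)
        then show ?case
          by (blast intro: less_imp_le order.trans)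
      qed
    qed
  qed (auto intro!: always_eventually)
qed

end

section \<open>Reduction to the centred sample\<close>

lemma (in prob_space) indep_vars_Suc:
  assumes "indep_vars N X {1..}"
  shows "indep_vars (\<lambda>i. N (Suc i)) (\<lambda>i. X (Suc i)) UNIV"
  unfolding indep_vars_def2
proof (intro conjI ballI)
  have rv: "\<forall>i\<in>{1..}. random_variable (N i) (X i)"
    and ind: "indep_sets (\<lambda>i. {X i -` A \<inter> space M | A. A \<in> sets (N i)}) {1..}"
    using assms unfolding indep_vars_def2 by auto
  then show "random_variable (N (Suc i)) (X (Suc i))" for i
    by simp
  let ?F = "\<lambda>i. {X i -` A \<inter> space M | A. A \<in> sets (N i)}"
  show "indep_sets (\<lambda>i. ?F (Suc i)) UNIV"
  proof (rule indep_setsI)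
    show "?F (Suc i) \<subseteq> events" for i
      using ind by (simp add: indep_sets_def)
    fix A J assume J: "J \<noteq> {}" "J \<subseteq> UNIV" "finite J" and A: "\<forall>j\<in>J. A j \<in> ?F (Suc j)"
    have "prob (\<Inter>j\<in>Suc ` J. A (j - 1)) = (\<Prod>j\<in>Suc ` J. prob (A (j - 1)))"
      by (rule indep_setsD[OF ind]) (use J A in auto)
    then show "prob (\<Inter>j\<in>J. A j) = (\<Prod>j\<in>J. prob (A j))"
      by (simp add: prod.reindex)
  qed
qed

text \<open>For c > 1 close to 1 the lower limit of f(c x) / f(x) exceeds 1 / (1 + e), and
  eventually so does the quotient itself.\<close>

lemma intermediate_regularly_varying_dominated:
  assumes "intermediate_regularly_varying f" "e > 0"
  shows "\<exists>c>1. \<forall>\<^sub>F u in at_top. f u \<le> (1 + e) * f (c * u)"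
proof -
  have "((\<lambda>c. Liminf at_top (\<lambda>x. ereal (f (c * x) / f x))) \<longlongrightarrow> 1) (at_right 1)"
    and pos: "\<forall>\<^sub>F x in at_top. f x > 0"
    using assms(1) unfolding intermediate_regularly_varying_def by auto
  moreover have "ereal (1 / (1 + e)) < 1"
    using assms(2) by simp
  ultimately have "\<forall>\<^sub>F c in at_right 1. ereal (1 / (1 + e)) < Liminf at_top (\<lambda>x. ereal (f (c * x) / f x))"
    by (intro order_tendstoD(1))
  then have "\<forall>\<^sub>F c in at_right 1. 1 < c \<and> ereal (1 / (1 + e)) < Liminf at_top (\<lambda>x. ereal (f (c * x) / f x))"
    using eventually_at_right_less[of 1] by eventually_elim simp
  then obtain c where c: "1 < c" "ereal (1 / (1 + e)) < Liminf at_top (\<lambda>x. ereal (f (c * x) / f x))"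
    using eventually_happens'[OF trivial_limit_at_right_real] by blast
  have "\<forall>\<^sub>F x in at_top. f x \<le> (1 + e) * f (c * x)"
    using less_LiminfD[OF c(2)] pos
  proof eventually_elim
    case (elim x)
    then have "1 / (1 + e) < f (c * x) / f x"
      by simp
    with elim(2) assms(2) show ?case
      by (simp add: field_simps)
  qed
  with c(1) show ?thesis
    by blast
qed

lemma (in prob_space) tail_eq:
  assumes [measurable]: "\<xi> \<in> borel_measurable M"
  shows "tail M \<xi> u = prob {\<omega>\<in>space M. \<xi> \<omega> > u}"
proof -
  have "cdf (distr M borel \<xi>) u = prob {\<omega>\<in>space M. \<xi> \<omega> \<le> u}"
    unfolding cdf_def by (subst measure_distr) (auto intro!: arg_cong[where f = prob])
  also have "\<dots> = 1 - prob (space M - {\<omega>\<in>space M. \<xi> \<omega> \<le> u})"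
    by (subst prob_compl) auto
  also have "space M - {\<omega>\<in>space M. \<xi> \<omega> \<le> u} = {\<omega>\<in>space M. \<xi> \<omega> > u}"
    by auto
  finally show ?thesis
    by (simp add: tail_def)
qed

text \<open>Passing from c to a smaller d > 1 gains room for the shift: d u + m <= c (u + m) for
  large u, and monotonicity does the rest.\<close>

lemma antimono_shift_dominated:
  fixes f :: "real \<Rightarrow> real"
  assumes "antimono f" "c > 1" "e > 0" and dom: "\<forall>\<^sub>F u in at_top. f u \<le> (1 + e) * f (c * u)"
  shows "\<exists>c>1. \<forall>\<^sub>F u in at_top. f (u + m) \<le> (1 + e) * f (c * u + m)"
proof -
  define d where "d = (1 + c) / 2"
  have d: "1 < d" "d < c"
    using \<open>c > 1\<close> by (auto simp: d_def)
  have "filterlim (\<lambda>u. m + u) at_top at_top"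
    by (rule filterlim_tendsto_add_at_top[OF tendsto_const filterlim_ident])
  then have "\<forall>\<^sub>F u in at_top. f (m + u) \<le> (1 + e) * f (c * (m + u))"
    using dom unfolding filterlim_iff by blast
  then have "\<forall>\<^sub>F u in at_top. f (u + m) \<le> (1 + e) * f (d * u + m)"
    using eventually_ge_at_top[of "(1 - c) * m / (c - d)"]
  proof eventually_elim
    case (elim u)
    have "(1 - c) * m \<le> u * (c - d)"
      using elim(2) d by (simp add: pos_divide_le_eq)
    then have "d * u + m \<le> c * (m + u)"
      by (simp add: algebra_simps)
    then have "(1 + e) * f (c * (m + u)) \<le> (1 + e) * f (d * u + m)"
      using antimonoD[OF assms(1)] assms(3) by (intro mult_left_mono) auto
    with elim(1) show ?case
      by (simp add: add.commute)
  qed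
  with d(1) show ?thesis
    by blast
qed

lemma partial_sum_conv: "partial_sum X n \<omega> - real n * \<mu> = (\<Sum>j<n. X (Suc j) \<omega> - \<mu>)"
  unfolding partial_sum_def by (simp add: sum.atLeast1_atMost_eq sum_subtractf)

lemma partial_max_conv:
  assumes "n \<ge> 1"
  shows "partial_max X n \<omega> > t \<longleftrightarrow> (\<exists>i<n. X (Suc i) \<omega> - \<mu> > t - \<mu>)"
    and "partial_max X n \<omega> \<ge> t \<longleftrightarrow> (\<exists>i<n. X (Suc i) \<omega> - \<mu> \<ge> t - \<mu>)"
proof -
  have eq: "(\<lambda>i. X i \<omega>) ` {1..n} = (\<lambda>i. X (Suc i) \<omega>) ` {..<n}"
    unfolding image_Suc_lessThan[symmetric] image_image ..
  have fin: "finite ((\<lambda>i. X (Suc i) \<omega>) ` {..<n})" "(\<lambda>i. X (Suc i) \<omega>) ` {..<n} \<noteq> {}"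
    using assms by (auto simp: lessThan_empty_iff)
  show "partial_max X n \<omega> > t \<longleftrightarrow> (\<exists>i<n. X (Suc i) \<omega> - \<mu> > t - \<mu>)"
    unfolding partial_max_def eq Max_gr_iff[OF fin] by auto
  show "partial_max X n \<omega> \<ge> t \<longleftrightarrow> (\<exists>i<n. X (Suc i) \<omega> - \<mu> \<ge> t - \<mu>)"
    unfolding partial_max_def eq Max_ge_iff[OF fin] by auto
qed

text \<open>Every probability is compared with n G(x) for the centred sample, and the stated
  equivalences follow by transitivity, using \<open>G_shift_tendsto\<close> wherever the uncentred
  tail appears.\<close>

theorem proposition2p8:
  fixes M :: "'a measure"
    and \<xi> :: "'a \<Rightarrow> real"
    and X :: "nat \<Rightarrow> 'a \<Rightarrow> real"
    and a b x :: "nat \<Rightarrow> real"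
    and r :: "real \<Rightarrow> real"
    and \<mu> :: real
  assumes "prob_space M"
    and "\<xi> \<in> borel_measurable M"
    and "prob_space.indep_vars M (\<lambda>_. borel) X {1..}"
    and "\<And>i. i \<ge> 1 \<Longrightarrow> distr M borel (X i) = distr M borel \<xi>"
    and "integrable M \<xi>"
    and "\<mu> = (\<integral>\<omega>. \<xi> \<omega> \<partial>M)"
    and "slowly_varying (trunc_var M \<xi>)"
    and "\<And>n. n \<ge> 1 \<Longrightarrow> a n > 0"
    and "filterlim a at_top sequentially"
    and "(\<lambda>n. trunc_var M \<xi> (a n) / (a n)\<^sup>2) \<sim>[sequentially] (\<lambda>n. 1 / real n)"
    and "\<And>n. b n = real n * \<mu>"
    and "\<And>t. t > 0 \<Longrightarrow> r t \<ge> 0"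
    and "filterlim r at_top at_top"
    and "(\<lambda>t. r t / trunc_var M \<xi> (r t)) \<sim>[at_top] (\<lambda>t. t)"
    and "intermediate_regularly_varying (tail M \<xi>)"
    and "\<And>n. n \<ge> 1 \<Longrightarrow> x n > 0"
  shows
    "(filterlim (\<lambda>n. x n / a n) at_top sequentially \<and> (\<lambda>n. x n / real n) \<longlonglongrightarrow> 0 \<longrightarrow>
        (\<lambda>n. \<P>(\<omega> in M. partial_sum X n \<omega> - b n \<ge> x n \<and> partial_max X n \<omega> > r (real n / x n)))
          \<sim>[sequentially]
        (\<lambda>n. \<P>(\<omega> in M. partial_sum X n \<omega> - b n \<ge> x n \<and> partial_max X n \<omega> \<ge> x n))
        \<and>
        (\<exists>\<epsilon>. \<epsilon> \<longlonglongrightarrow> 0 \<and>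
          (\<forall>n\<ge>1. \<P>(\<omega> in M. partial_sum X n \<omega> - b n \<ge> x n) =
             \<P>(\<omega> in M. partial_sum X n \<omega> - b n \<ge> x n \<and> partial_max X n \<omega> \<le> r (real n / x n))
             + (1 + \<epsilon> n) * (real n * tail M \<xi> (x n)))))
     \<and>
     (liminf (\<lambda>n. ereal (x n / real n)) > 0 \<longrightarrow>
        (\<lambda>n. \<P>(\<omega> in M. partial_sum X n \<omega> - b n \<ge> x n))
          \<sim>[sequentially]
        (\<lambda>n. \<P>(\<omega> in M. partial_sum X n \<omega> - b n \<ge> x n \<and> partial_max X n \<omega> \<ge> x n))
        \<and>
        (\<lambda>n. \<P>(\<omega> in M. partial_sum X n \<omega> - b n \<ge> x n \<and> partial_max X n \<omega> \<ge> x n))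
          \<sim>[sequentially]
        (\<lambda>n. real n * tail M \<xi> (x n)))"
proof -
  interpret prob_space M
    by (rule assms(1))
  note \<xi> [measurable] = assms(2)
  define D where "D = distr M borel (\<lambda>\<omega>. \<xi> \<omega> - \<mu>)"
  define Y where "Y i \<omega> = X (Suc i) \<omega> - \<mu>" for i \<omega>
  have X [measurable]: "X (Suc i) \<in> borel_measurable M" for i
    using assms(3) by (auto simp: indep_vars_def)
  have law: "centered_law D"
  proof -
    interpret D: prob_space D
      unfolding D_def by (rule prob_space_distr) measurable
    show ?thesis
    proof
      show "sets D = sets borel"
        by (simp add: D_def)
      show "integrable D (\<lambda>t. t)"
        using assms(5) by (simp add: D_def integrable_distr_eq)
      show "(\<integral>t. t \<partial>D) = 0"
        using assms(5,6) prob_space by (simp add: D_def integral_distr)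
    qed
  qed
  have V: "trunc_second_moment D = trunc_var M \<xi>"
  proof
    fix y
    have "trunc_second_moment D y = (\<integral>\<omega>. (\<xi> \<omega> - \<mu>)\<^sup>2 * indicator {t. \<bar>t\<bar> \<le> y} (\<xi> \<omega> - \<mu>) \<partial>M)"
      unfolding trunc_second_moment_def D_def by (rule integral_distr) measurable
    also have "\<dots> = trunc_var M \<xi> y"
      unfolding trunc_var_def Let_def assms(6)[symmetric]
      by (intro Bochner_Integration.integral_cong) (auto simp: indicator_def)
    finally show "trunc_second_moment D y = trunc_var M \<xi> y" .
  qed
  have G: "upper_tail D u = tail M \<xi> (u + \<mu>)" for u
    unfolding upper_tail_def D_def tail_eq[OF \<xi>]
    by (subst measure_distr) (auto intro!: arg_cong[where f = prob] simp: algebra_simps)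
  interpret iid_sample M D Y
  proof (intro iid_sample.intro law iid_sample_axioms.intro prob_space_axioms)
    show "indep_vars (\<lambda>_. borel) Y UNIV"
      unfolding Y_def by (rule indep_vars_compose2[OF indep_vars_Suc[OF assms(3)]]) measurable
    have distr_shift: "distr M borel (\<lambda>\<omega>. Z \<omega> - \<mu>) = distr (distr M borel Z) borel (\<lambda>t. t - \<mu>)"
      if "Z \<in> borel_measurable M" for Z
      using that by (subst distr_distr) (auto simp: comp_def)
    show "distr M borel (Y i) = D" for i
      using assms(4)[of "Suc i"] unfolding D_def Y_def by (simp add: distr_shift)
  qed
  have tail_antimono: "antimono (tail M \<xi>)"
    unfolding tail_eq[OF \<xi>] by (intro antimonoI finite_measure_mono) auto
  interpret regular_sample M D Y
  proof
    show "slowly_varying V"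
      using assms(7) by (simp add: V)
    show "0 < G u" for u
    proof -
      obtain N where N: "\<And>v. v \<ge> N \<Longrightarrow> tail M \<xi> v > 0"
        using assms(15) unfolding intermediate_regularly_varying_def eventually_at_top_linorder by blast
      define v where "v = max N (u + \<mu>)"
      have v: "v \<ge> u + \<mu>" "tail M \<xi> v > 0"
        using N[of v] by (simp_all add: v_def)
      then show ?thesis
        using antimonoD[OF tail_antimono v(1)] by (simp add: G)
    qed
    fix e :: real assume e: "e > 0"
    obtain c where "c > 1" "\<forall>\<^sub>F u in at_top. tail M \<xi> u \<le> (1 + e) * tail M \<xi> (c * u)"
      using intermediate_regularly_varying_dominated[OF assms(15) e] by blast
    then show "\<exists>c>1. \<forall>\<^sub>F u in at_top. G u \<le> (1 + e) * G (c * u)"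
      unfolding G by (rule antimono_shift_dominated[OF tail_antimono _ e])
  qed
  have tail_pos: "tail M \<xi> u > 0" for u
    using G_pos[of "u - \<mu>"] by (simp add: G)
  \<comment> \<open>With shift \<mu>, G(x - \<mu>) is exactly the uncentred tail at x.\<close>
  have tail_ratio: "(\<lambda>n. tail M \<xi> (x n) / G (x n)) \<longlonglongrightarrow> 1" if "filterlim x at_top sequentially"
    using filterlim_compose[OF G_shift_tendsto[of \<mu>] that] by (simp add: G)
  have sum_conv: "partial_sum X n \<omega> - b n = (\<Sum>j<n. Y j \<omega>)" for n \<omega>
    unfolding assms(11) Y_def by (rule partial_sum_conv)
  note max_conv = partial_max_conv[where X = X and \<mu> = \<mu>, folded Y_def]
  let ?\<rho> = "\<lambda>n. r (real n / x n)"
  let ?S = "\<lambda>n. \<P>(\<omega> in M. partial_sum X n \<omega> - b n \<ge> x n)"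
  let ?P = "\<lambda>n. \<P>(\<omega> in M. partial_sum X n \<omega> - b n \<ge> x n \<and> partial_max X n \<omega> > ?\<rho> n)"
  let ?P' = "\<lambda>n. \<P>(\<omega> in M. partial_sum X n \<omega> - b n \<ge> x n \<and> partial_max X n \<omega> \<le> ?\<rho> n)"
  let ?Q = "\<lambda>n. \<P>(\<omega> in M. partial_sum X n \<omega> - b n \<ge> x n \<and> partial_max X n \<omega> \<ge> x n)"
  have P_conv: "?P n = prob {\<omega>\<in>space M. x n \<le> (\<Sum>j<n. Y j \<omega>) \<and> (\<exists>i<n. Y i \<omega> > ?\<rho> n - \<mu>)}" if "n \<ge> 1" for n
    using max_conv(1)[OF that] by (simp add: sum_conv)
  have P'_conv: "?P' n = prob {\<omega>\<in>space M. x n \<le> (\<Sum>j<n. Y j \<omega>) \<and> \<not> (\<exists>i<n. Y i \<omega> > ?\<rho> n - \<mu>)}" if "n \<ge> 1" for n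
    unfolding max_conv(1)[OF that, symmetric] not_less sum_conv ..
  have Q_conv: "?Q n = prob {\<omega>\<in>space M. x n \<le> (\<Sum>j<n. Y j \<omega>) \<and> (\<exists>i<n. Y i \<omega> \<ge> x n - \<mu>)}" if "n \<ge> 1" for n
    using max_conv(2)[OF that] by (simp add: sum_conv)
  have equiv: "f \<sim>[sequentially] (\<lambda>n. real n * G (x n))"
    if "(\<lambda>n. g n / (real n * G (x n))) \<longlonglongrightarrow> 1" "\<And>n. n \<ge> 1 \<Longrightarrow> f n = g n" for f g
  proof (rule asymp_equivI')
    have "\<forall>\<^sub>F n in sequentially. g n / (real n * G (x n)) = f n / (real n * G (x n))"
      using eventually_ge_at_top[of 1] by eventually_elim (simp add: that(2))
    then show "(\<lambda>n. f n / (real n * G (x n))) \<longlonglongrightarrow> 1"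
      by (rule Lim_transform_eventually[OF that(1)])
  qed
  have tail_equiv: "(\<lambda>n. real n * tail M \<xi> (x n)) \<sim>[sequentially] (\<lambda>n. real n * G (x n))"
    if "filterlim x at_top sequentially"
    by (intro asymp_equiv_intros asymp_equivI' tail_ratio that)
  have case1: "?P \<sim>[sequentially] ?Q \<and> (\<exists>\<epsilon>. \<epsilon> \<longlonglongrightarrow> 0 \<and>
      (\<forall>n\<ge>1. ?S n = ?P' n + (1 + \<epsilon> n) * (real n * tail M \<xi> (x n))))"
    if xa: "filterlim (\<lambda>n. x n / a n) at_top sequentially" and xn: "(\<lambda>n. x n / real n) \<longlonglongrightarrow> 0"
  proof -
    have pos: "\<forall>\<^sub>F n in sequentially. x n > 0 \<and> real n > 0"
      using eventually_ge_at_top[of 1] by eventually_elim (simp add: assms(16))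
    have t: "filterlim (\<lambda>n. real n / x n) at_top sequentially"
    proof -
      have "filterlim (\<lambda>n. inverse (x n / real n)) at_top sequentially"
        using pos by (intro filterlim_inverse_at_top[OF xn]) (auto elim!: eventually_mono)
      then show ?thesis
        by simp
    qed
    have \<rho>: "filterlim ?\<rho> at_top sequentially"
      by (rule filterlim_compose[OF assms(13) t])
    have "((\<lambda>t. r t / V (r t) / t) \<longlongrightarrow> 1) at_top"
      unfolding V
      by (rule asymp_equivD_strong[OF assms(14)], rule eventually_mono[OF eventually_gt_at_top[of 0]]) simp
    from filterlim_compose[OF this t]
    have lim: "(\<lambda>n. ?\<rho> n / V (?\<rho> n) / (real n / x n)) \<longlonglongrightarrow> 1" .
    have "\<forall>\<^sub>F n in sequentially. ?\<rho> n > 0"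
      using \<rho> unfolding filterlim_at_top_dense by blast
    moreover have "\<forall>\<^sub>F n in sequentially. V (?\<rho> n) > 0"
      using slow eventually_compose_filterlim[OF _ \<rho>] unfolding slowly_varying_def by blast
    moreover have "\<forall>\<^sub>F n in sequentially. 1 / 2 < ?\<rho> n / V (?\<rho> n) / (real n / x n)"
      "\<forall>\<^sub>F n in sequentially. ?\<rho> n / V (?\<rho> n) / (real n / x n) < 2"
      by (rule order_tendstoD(1)[OF lim] order_tendstoD(2)[OF lim], simp)+
    ultimately have "\<forall>\<^sub>F n in sequentially. real n * V (?\<rho> n) / ?\<rho> n \<le> 2 * x n \<and>
        x n \<le> 2 * (real n * V (?\<rho> n) / ?\<rho> n)"
      using pos
    proof eventually_elim
      case (elim n)
      \<comment> \<open>The quotient known to tend to 1 is x / q, so being between 1 / 2 and 2 gives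
        both comparisons of x with q.\<close>
      define q where "q = real n * V (?\<rho> n) / ?\<rho> n"
      have "q > 0" and eq: "?\<rho> n / V (?\<rho> n) / (real n / x n) = x n / q"
        using elim by (simp_all add: q_def mult_ac)
      have "q < 2 * x n" "x n < 2 * q"
        using elim(3,4) \<open>q > 0\<close> unfolding eq by (simp_all add: field_simps)
      then show ?case
        unfolding q_def by linarith
    qed
    then have \<rho>_bounds: "\<forall>\<^sub>F n in sequentially. real n * V (?\<rho> n) / ?\<rho> n \<le> 2 * x n"
      "\<forall>\<^sub>F n in sequentially. x n \<le> 2 * (real n * V (?\<rho> n) / ?\<rho> n)"
      by (auto elim!: eventually_mono)
    have aV: "(\<lambda>n. real n * V (a n) / (a n)\<^sup>2) \<longlonglongrightarrow> 1"
    proof -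
      have "(\<lambda>n. trunc_var M \<xi> (a n) / (a n)\<^sup>2 / (1 / real n)) \<longlonglongrightarrow> 1"
        by (rule asymp_equivD_strong[OF assms(10)], rule eventually_mono[OF eventually_gt_at_top[of 0]]) simp
      then show ?thesis
        by (simp add: V mult.commute)
    qed
    note facts = assms(9) aV xa \<rho> \<rho>_bounds
    note x = sublinear_threshold_facts(1)[OF facts]
    have PG: "?P \<sim>[sequentially] (\<lambda>n. real n * G (x n))"
      by (rule equiv[OF sublinear_threshold_max(1)[OF facts] P_conv])
    have QG: "?Q \<sim>[sequentially] (\<lambda>n. real n * G (x n))"
      by (rule equiv[OF sublinear_threshold_max(2)[OF facts] Q_conv])
    have "?P \<sim>[sequentially] (\<lambda>n. real n * tail M \<xi> (x n))"
      by (rule asymp_equiv_trans[OF PG asymp_equiv_symI[OF tail_equiv[OF x]]])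
    then have ratio: "(\<lambda>n. ?P n / (real n * tail M \<xi> (x n))) \<longlonglongrightarrow> 1"
    proof (rule asymp_equivD_strong)
      show "\<forall>\<^sub>F n in sequentially. ?P n \<noteq> 0 \<or> real n * tail M \<xi> (x n) \<noteq> 0"
        using eventually_gt_at_top[of 0]
      proof eventually_elim
        case (elim n)
        then show ?case
          using tail_pos[of "x n"] by simp
      qed
    qed
    \<comment> \<open>Defined as the relative error of \<open>?P\<close>, so that splitting
      \<open>?S\<close> by the maximum gives an exact identity for every n >= 1, not only for large
      n.\<close>
    define \<epsilon> where "\<epsilon> n = ?P n / (real n * tail M \<xi> (x n)) - 1" for n
    have "\<epsilon> \<longlonglongrightarrow> 0"
      using tendsto_diff[OF ratio tendsto_const[of 1]] by (simp add: \<epsilon>_def[abs_def])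
    moreover have "?S n = ?P' n + (1 + \<epsilon> n) * (real n * tail M \<xi> (x n))" if n: "n \<ge> 1" for n
    proof -
      have "real n * tail M \<xi> (x n) \<noteq> 0"
        using n tail_pos[of "x n"] by simp
      then have "(1 + \<epsilon> n) * (real n * tail M \<xi> (x n)) = ?P n"
        unfolding \<epsilon>_def by simp
      moreover have "?S n = ?P' n + ?P n"
        unfolding P_conv[OF n] P'_conv[OF n] unfolding sum_conv
        by (subst finite_measure_Union[symmetric]) (auto intro!: arg_cong[where f = prob])
      ultimately show ?thesis
        by simp
    qed
    moreover have "?P \<sim>[sequentially] ?Q"
      by (rule asymp_equiv_trans[OF PG asymp_equiv_symI[OF QG]])
    ultimately show ?thesis
      by blast
  qed
  have case2: "?S \<sim>[sequentially] ?Q \<and> ?Q \<sim>[sequentially] (\<lambda>n. real n * tail M \<xi> (x n))"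
    if liminf_pos: "liminf (\<lambda>n. ereal (x n / real n)) > 0"
  proof -
    \<comment> \<open>The lower limit may be infinite; density provides a finite positive \<kappa>
      below it.\<close>
    obtain \<kappa> where \<kappa>: "0 < ereal \<kappa>" "ereal \<kappa> < liminf (\<lambda>n. ereal (x n / real n))"
      using ereal_dense2[OF liminf_pos] by blast
    have "\<forall>\<^sub>F n in sequentially. \<kappa> * real n \<le> x n"
      using less_LiminfD[OF \<kappa>(2)] eventually_gt_at_top[of 0]
      by eventually_elim (simp add: field_simps)
    moreover have "\<kappa> > 0"
      using \<kappa>(1) by simp
    ultimately have facts: "\<kappa> > 0" "\<forall>\<^sub>F n in sequentially. \<kappa> * real n \<le> x n"
      by auto
    have SG: "?S \<sim>[sequentially] (\<lambda>n. real n * G (x n))"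
      by (rule equiv[OF linear_threshold_max(2)[OF facts]]) (simp add: sum_conv)
    have QG: "?Q \<sim>[sequentially] (\<lambda>n. real n * G (x n))"
      by (rule equiv[OF linear_threshold_max(3)[OF facts] Q_conv])
    show ?thesis
      using asymp_equiv_trans[OF SG asymp_equiv_symI[OF QG]]
        asymp_equiv_trans[OF QG asymp_equiv_symI[OF tail_equiv[OF linear_threshold_max(1)[OF facts]]]]
      by (rule conjI)
  qed
  show ?thesis
    using case1 case2 by blast
qed

end
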